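(* Let $y\in\mathbb{C}$. If $f$ is an entire function which satisfies the functional equations $$f(z)=f(z+\pi)=q^2e^{8iz+2iy}f(z+\pi\tau),$$ then $$\frac{2\theta_1(y|\tau)f(z)}{\theta_1(2z|\tau)}=f(0)\frac{\theta_1(z+y|\tau)}{\theta_1(z|\tau)}-f\left(\frac{\pi}{2}\right)\frac{\theta_2(z+y|\tau)}{\theta_2(z|\tau)}+q^{1/2}f\left(\frac{\pi+\pi\tau}{2}\right)\frac{e^{iy}\theta_3(z+y|\tau)}{\theta_3(z|\tau)}-q^{1/2}f\left(\frac{\pi\tau}{2}\right)\frac{e^{iy}\theta_4(z+y|\tau)}{\theta_4(z|\tau)}$$ as an identity of meromorphic functions of $z$.
   Context: Fix $\tau\in\mathbb{C}$ with $\mathrm{Im}\,\tau>0$ and put $q=e^{2\pi i\tau}$, with $q^{s}=e^{2\pi i s\tau}$. The Jacobi theta functions are the entire functions of $z$ $$\theta_1(z|\tau)=2\sum_{n=0}^\infty(-1)^n q^{(2n+1)^2/8}\sin((2n+1)z),\quad \theta_2(z|\tau)=2\sum_{n=0}^\infty q^{(2n+1)^2/8}\cos((2n+1)z),$$ $$\theta_3(z|\tau)=1+2\sum_{n=1}^\infty q^{n^2/2}\cos(2nz),\quad \theta_4(z|\tau)=1+2\sum_{n=1}^\infty(-1)^n q^{n^2/2}\cos(2nz).$$ *)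

theory Defs
  imports "HOL-Complex_Analysis.Complex_Analysis"
begin

(* The power q^s for q = exp (2 pi i tau).  It is a function of tau and not only of the number q:
   for non-integer s the branch is fixed by the choice of tau. *)
definition qpow :: "complex \<Rightarrow> real \<Rightarrow> complex" where
  "qpow \<tau> s = exp (2 * of_real pi * \<i> * of_real s * \<tau>)"

(* Convention: the period pi goes with the first argument z, as in theta_i (z | tau).
   The series converge for Im tau > 0.  In theta_3 and theta_4 the summation index n \<ge> 1 of
   the classical series is written Suc n. *)

definition jtheta1 :: "complex \<Rightarrow> complex \<Rightarrow> complex" where
  "jtheta1 z \<tau> =
     2 * (\<Sum>n. (-1) ^ n * qpow \<tau> ((2 * real n + 1)\<^sup>2 / 8) * sin ((2 * of_nat n + 1) * z))"

definition jtheta2 :: "complex \<Rightarrow> complex \<Rightarrow> complex" where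
  "jtheta2 z \<tau> =
     2 * (\<Sum>n. qpow \<tau> ((2 * real n + 1)\<^sup>2 / 8) * cos ((2 * of_nat n + 1) * z))"

definition jtheta3 :: "complex \<Rightarrow> complex \<Rightarrow> complex" where
  "jtheta3 z \<tau> =
     1 + 2 * (\<Sum>n. qpow \<tau> ((real (Suc n))\<^sup>2 / 2) * cos (2 * of_nat (Suc n) * z))"

definition jtheta4 :: "complex \<Rightarrow> complex \<Rightarrow> complex" where
  "jtheta4 z \<tau> =
     1 + 2 * (\<Sum>n. (-1) ^ Suc n * qpow \<tau> ((real (Suc n))\<^sup>2 / 2) * cos (2 * of_nat (Suc n) * z))"

end

theory Submission
  imports Defs
begin

text \<open>
  Fix \<open>y\<close> and let \<open>E\<close> be the difference of the two sides multiplied by \<open>\<theta>\<^sub>1(2z)\<close>.  It is entire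
  and vanishes at the half periods, which are exactly the (simple) zeros of \<open>\<theta>\<^sub>1(2z)\<close>; so
  \<open>E = \<theta>\<^sub>1(2z) D\<close> with \<open>D\<close> entire, \<open>D(z + \<pi>) = D(z)\<close> and \<open>D(z + \<pi>\<tau>) = e\<^bsup>-2iy\<^esup> D(z)\<close>.  By
  Liouville's theorem \<open>D\<close> is a multiple of a single exponential \<open>e\<^bsup>2inz\<^esup>\<close>, and it is zero unless \<open>y\<close>
  is a period.  If \<open>y\<close> is a period, the left-hand side is zero, and multiplying \<open>f\<close> by an exponential
  reduces the claim to a linear relation between the values of \<open>f\<close> at the four half periods, in the
  case \<open>y = 0\<close>; this follows from the symmetries of \<open>f\<close>.  The zeros of \<open>\<theta>\<^sub>1\<close> are found by
  comparing it with an explicit infinite product that has the same quasi-periods.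
\<close>

subsection \<open>Entire functions\<close>

text \<open>The quotient of consecutive terms is \<open>c n * x\<close>, which tends to 0 for every
  \<open>x\<close>; the ratio test thus gives an infinite radius of convergence.\<close>

lemma summable_norm_power_series_ratio:
  fixes a c :: "nat \<Rightarrow> complex"
  assumes rec: "\<And>n. a (Suc n) = c n * a n" and lim: "c \<longlonglongrightarrow> 0"
  shows "summable (\<lambda>n. norm (a n * x ^ n))"
proof -
  have "(\<lambda>n. norm (c n * x)) \<longlonglongrightarrow> 0"
    using tendsto_norm[OF tendsto_mult_right[OF lim, of x]] by simp
  then have "eventually (\<lambda>n. norm (c n * x) < 1/2) sequentially"
    by (rule order_tendstoD) simp
  then obtain N where N: "\<And>n. n \<ge> N \<Longrightarrow> norm (c n * x) < 1/2"
    by (auto simp: eventually_sequentially)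
  show ?thesis
  proof (rule summable_ratio_test[of "1/2" N])
    fix n assume "n \<ge> N"
    have "norm (a (Suc n) * x ^ Suc n) = norm (c n * x) * norm (a n * x ^ n)"
      by (simp add: rec norm_mult mult_ac)
    also have "\<dots> \<le> 1/2 * norm (a n * x ^ n)"
      using N[OF \<open>n \<ge> N\<close>] by (intro mult_right_mono) auto
    finally show "norm (norm (a (Suc n) * x ^ Suc n)) \<le> 1/2 * norm (norm (a n * x ^ n))"
      by simp
  qed simp
qed

lemma holomorphic_power_series_UNIV:
  fixes a :: "nat \<Rightarrow> complex"
  assumes "\<And>x. summable (\<lambda>n. norm (a n * x ^ n))"
  shows "(\<lambda>x. \<Sum>n. a n * x ^ n) holomorphic_on UNIV"
proof -
  have "(\<lambda>x. \<Sum>n. a n * x ^ n) holomorphic_on ball 0 r" for r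
    by (rule power_series_holomorphic[where a = a])
       (use summable_sums[OF summable_norm_cancel[OF assms]] in auto)
  then have "(\<lambda>x. \<Sum>n. a n * x ^ n) holomorphic_on (\<Union>r. ball 0 r)"
    by (intro holomorphic_on_UN_open) auto
  also have "(\<Union>r. ball 0 r) = (UNIV :: complex set)"
    using gt_ex by fastforce
  finally show ?thesis .
qed

text \<open>The values of \<open>F\<close> may have any type, so that norms and predicates such as
  \<open>T z = 0\<close> count as periodic functions even when \<open>T\<close> itself has
  multipliers.\<close>

lemma periodic_of_int:
  fixes F :: "complex \<Rightarrow> 'a"
  assumes "\<And>z. F (z + w) = F z"
  shows "F (z + of_int n * w) = F z"
proof (induction n arbitrary: z rule: int_induct[of _ 0])
  case (step1 i)
  then show ?case
    using assms[of "z + of_int i * w"] by (simp add: algebra_simps)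
next
  case (step2 i)
  then show ?case
    using assms[of "z + of_int (i - 1) * w"] by (simp add: algebra_simps)
qed simp

text \<open>Near a common zero both functions are divisible by the linear factor, and the cofactor
  of \<open>p\<close> does not vanish there because the zero is simple. This produces the entire
  quotients to which Liouville's theorem is applied.\<close>

lemma entire_factor_simple_zeros:
  fixes h p :: "complex \<Rightarrow> complex"
  assumes h: "h holomorphic_on UNIV" and p: "p holomorphic_on UNIV"
    and simple: "\<And>z. p z = 0 \<Longrightarrow> deriv p z \<noteq> 0"
    and zero: "\<And>z. p z = 0 \<Longrightarrow> h z = 0"
  obtains k where "k holomorphic_on UNIV" "\<And>z. h z = p z * k z"
proof -
  \<comment> \<open>At a zero of \<open>p\<close> the quotient takes its limit by de l'Hopital's
    rule.\<close>
  define k where "k = (\<lambda>z. if p z = 0 then deriv h z / deriv p z else h z / p z)"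
  have "k analytic_on {a}" for a
  proof (cases "p a = 0")
    case False
    have "open {z. p z \<noteq> 0}"
      using p by (intro open_Collect_neq holomorphic_on_imp_continuous_on) auto
    moreover have "(\<lambda>z. h z / p z) holomorphic_on {z. p z \<noteq> 0}"
      by (intro holomorphic_intros holomorphic_on_subset[OF h] holomorphic_on_subset[OF p]) auto
    then have "k holomorphic_on {z. p z \<noteq> 0}"
      by (rule holomorphic_transform) (auto simp: k_def)
    ultimately show ?thesis
      using False by (auto simp: analytic_at)
  next
    case True
    define p1 where "p1 = (\<lambda>z. if z = a then deriv p a else (p z - p a) / (z - a))"
    define h1 where "h1 = (\<lambda>z. if z = a then deriv h a else (h z - h a) / (z - a))"
    have hol1: "p1 holomorphic_on UNIV" "h1 holomorphic_on UNIV"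
      unfolding p1_def h1_def by (intro pole_lemma_open h p open_UNIV)+
    have "open {z. p1 z \<noteq> 0}"
      using hol1 by (intro open_Collect_neq holomorphic_on_imp_continuous_on) auto
    moreover have "p1 a \<noteq> 0"
      using simple[OF True] by (simp add: p1_def)
    moreover have "(\<lambda>z. h1 z / p1 z) holomorphic_on {z. p1 z \<noteq> 0}"
      by (intro holomorphic_intros holomorphic_on_subset[OF hol1(1)]
          holomorphic_on_subset[OF hol1(2)]) auto
    \<comment> \<open>On this neighbourhood of \<open>a\<close> the only zero of \<open>p\<close> is
      \<open>a\<close>, and elsewhere the factors \<open>z - a\<close> cancel in the
      quotient.\<close>
    then have "k holomorphic_on {z. p1 z \<noteq> 0}"
      by (rule holomorphic_transform)
        (use True zero[OF True] in \<open>auto simp: k_def p1_def h1_def split: if_splits\<close>)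
    ultimately show ?thesis
      by (auto simp: analytic_at)
  qed
  then have "k holomorphic_on UNIV"
    by (metis analytic_imp_holomorphic analytic_on_analytic_at)
  moreover have "h z = p z * k z" for z
    using zero by (simp add: k_def)
  ultimately show ?thesis by (rule that)
qed

text \<open>By the identity theorem, equality on the nonempty open set where
  \<open>p z \<noteq> 0\<close> suffices. Functional equations of a product are passed on in this
  way to a cofactor, also at the zeros of \<open>p\<close>.\<close>

lemma entire_mult_left_cancel:
  fixes p k l :: "complex \<Rightarrow> complex"
  assumes "p holomorphic_on UNIV" "k holomorphic_on UNIV" "l holomorphic_on UNIV"
    and "p a \<noteq> 0" and eq: "\<And>z. p z * k z = p z * l z"
  shows "k z = l z"
proof (rule analytic_continuation_open[of "{z. p z \<noteq> 0}" UNIV k l])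
  show "open {z. p z \<noteq> 0}"
    using assms(1) by (intro open_Collect_neq holomorphic_on_imp_continuous_on) auto
  show "{z. p z \<noteq> 0} \<noteq> {}" using \<open>p a \<noteq> 0\<close> by auto
  show "k z = l z" if "z \<in> {z. p z \<noteq> 0}" for z
    using eq[of z] that by simp
qed (use assms in auto)

lemma neg_mult_left_cancel:
  fixes e a b c :: complex
  assumes "- (e * a * b) = e * c" "e \<noteq> 0"
  shows "a * b = - c"
proof -
  have "e * (a * b + c) = 0"
    using assms(1) by (simp add: distrib_left mult.assoc flip: assms(1))
  then show ?thesis
    using assms(2) by (simp add: eq_neg_iff_add_eq_0)
qed

lemma exp_plus_2pi_int: "exp (w + 2 * of_int k * of_real pi * \<i>) = exp w"
  by (rule exp_eq[THEN iffD2]) (auto intro!: exI[of _ k])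

subsection \<open>Doubly quasi-periodic entire functions\<close>

locale upper_half_plane =
  fixes \<tau> :: complex
  assumes Im_pos: "Im \<tau> > 0"
begin

text \<open>Since \<open>Im \<tau> > 0\<close>, 1 and \<tau> form a real basis of the plane;
  \<open>A\<close> and \<open>B\<close> are the coordinates of \<open>z / pi\<close>, and
  \<open>a\<close>, \<open>b\<close> their fractional parts. Closed unit intervals make the
  parallelogram compact.\<close>

lemma lattice_reduction:
  obtains a b :: real and m n :: int
  where "a \<in> {0..1}" "b \<in> {0..1}"
    "z = (of_real (a * pi) + of_real (b * pi) * \<tau>) + of_int m * of_real pi
           + of_int n * (of_real pi * \<tau>)"
proof -
  define B where "B = Im z / (pi * Im \<tau>)"
  define A where "A = (Re z - B * pi * Re \<tau>) / pi"
  have z: "z = of_real (A * pi) + of_real (B * pi) * \<tau>"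
    using Im_pos by (auto simp: complex_eq_iff A_def B_def field_simps)
  show ?thesis
  proof (rule that[of "frac A" "frac B" "\<lfloor>A\<rfloor>" "\<lfloor>B\<rfloor>"])
    have "A = frac A + of_int \<lfloor>A\<rfloor>" "B = frac B + of_int \<lfloor>B\<rfloor>"
      by (simp_all add: frac_def)
    then have "z = of_real ((frac A + of_int \<lfloor>A\<rfloor>) * pi) + of_real ((frac B + of_int \<lfloor>B\<rfloor>) * pi) * \<tau>"
      using z by simp
    then show "z = (of_real (frac A * pi) + of_real (frac B * pi) * \<tau>) + of_int \<lfloor>A\<rfloor> * of_real pi
           + of_int \<lfloor>B\<rfloor> * (of_real pi * \<tau>)"
      by (simp add: algebra_simps)
  qed (simp_all add: frac_ge_0 less_imp_le[OF frac_lt_1])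
qed

text \<open>With a suitable exponential factor the norm of \<open>D\<close> becomes doubly periodic,
  hence bounded, and Liouville's theorem makes the product constant. The alternative
  \<open>c = 0\<close> remains because the zero function satisfies the equations for every
  multiplier.\<close>

lemma doubly_quasiperiodic_entire:
  assumes hol: "D holomorphic_on UNIV"
    and per: "\<And>z. D (z + of_real pi) = D z"
    and mult: "\<And>z. D (z + of_real pi * \<tau>) = \<mu> * D z" and "\<mu> \<noteq> 0"
  obtains c n where "\<And>z. D z = c * exp (2 * \<i> * of_int n * z)"
    "c = 0 \<or> \<mu> = exp (2 * \<i> * of_real pi * of_int n * \<tau>)"
proof -
  \<comment> \<open>A real exponent s can absorb the modulus of the multiplier without destroying the
      invariance of the norm under translation by pi.\<close>
  define s where "s = ln (norm \<mu>) / (2 * pi * Im \<tau>)"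
  define u where "u = (\<lambda>z. D z * exp (2 * \<i> * of_real s * z))"
  have s: "exp (2 * pi * s * Im \<tau>) = norm \<mu>"
    using Im_pos \<open>\<mu> \<noteq> 0\<close> by (simp add: s_def)
  have u1: "norm (u (z + of_real pi)) = norm (u z)" for z
    by (simp add: u_def per norm_mult)
  have u2: "norm (u (z + of_real pi * \<tau>)) = norm (u z)" for z
  proof -
    have "norm (u (z + of_real pi * \<tau>))
        = norm \<mu> * norm (D z) * exp (- (2 * s * Im z) - 2 * pi * s * Im \<tau>)"
      unfolding u_def mult by (simp add: norm_mult algebra_simps)
    also have "\<dots> = norm (D z) * exp (- (2 * s * Im z))"
      unfolding exp_diff s using \<open>\<mu> \<noteq> 0\<close> by simp
    finally show ?thesis
      by (simp add: u_def norm_mult)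
  qed
  have holu: "u holomorphic_on UNIV"
    unfolding u_def by (intro holomorphic_intros hol)
  define K where "K = (\<lambda>(a, b). of_real (a * pi) + of_real (b * pi) * \<tau>) ` ({0..1} \<times> {0..1::real})"
  have "compact K"
    unfolding K_def case_prod_unfold
    by (intro compact_continuous_image continuous_intros compact_Times) auto
  then have "compact (u ` K)"
    using holu by (intro compact_continuous_image)
      (auto intro: holomorphic_on_imp_continuous_on holomorphic_on_subset)
  then obtain M where M: "\<And>x. x \<in> K \<Longrightarrow> norm (u x) \<le> M"
    by (meson bounded_iff compact_imp_bounded imageI)
  have "norm (u z) \<le> M" for z
  proof -
    obtain a b m n where ab: "a \<in> {0..1}" "b \<in> {0..1}" and
      z: "z = (of_real (a * pi) + of_real (b * pi) * \<tau>) + of_int m * of_real pi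
           + of_int n * (of_real pi * \<tau>)"
      by (rule lattice_reduction)
    have "norm (u z) = norm (u (of_real (a * pi) + of_real (b * pi) * \<tau>))"
      unfolding z
      by (simp only: periodic_of_int[where F = "\<lambda>z. norm (u z)", OF u1]
          periodic_of_int[where F = "\<lambda>z. norm (u z)", OF u2])
    also have "\<dots> \<le> M"
      using ab by (intro M) (auto simp: K_def)
    finally show ?thesis .
  qed
  then have "bounded (range u)"
    by (auto simp: bounded_iff)
  with holu have "u constant_on UNIV"
    by (rule Liouville_theorem)
  then obtain c where c: "\<And>z. u z = c"
    by (auto simp: constant_on_def)
  have D: "D z = c * exp (- (2 * \<i> * of_real s * z))" for z
    using c[of z] by (simp add: u_def exp_minus field_simps)
  show ?thesis
  proof (cases "c = 0")
    case True
    then show ?thesis using D by (intro that[of 0 0]) auto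
  next
    case False
    \<comment> \<open>The period pi, used at the point 0, forces the real number \<open>s\<close> to
      be an integer.\<close>
    have "exp (- (2 * \<i> * of_real s * of_real pi)) = 1"
      using per[of 0] D False by simp
    then obtain k :: int where "- (2 * s * pi) = of_int (2 * k) * pi"
      by (auto simp: exp_eq_1)
    then have "(s + of_int k) * pi = 0"
      by (simp add: algebra_simps)
    then have k: "s = - of_int k"
      by (simp add: eq_neg_iff_add_eq_0)
    have "\<mu> = exp (2 * \<i> * of_real pi * of_int k * \<tau>)"
      using mult[of 0] D False by (simp add: k mult_ac)
    then show ?thesis using D by (intro that[of c k]) (auto simp: k)
  qed
qed

subsection \<open>Theta functions as Laurent series\<close>

text \<open>In terms of q = exp (2 pi i \<tau>) this is q^(1/2), the factor in front of the last two
  terms of the theorem.\<close>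

definition nome :: complex where
  "nome = exp (\<i> * of_real pi * \<tau>)"

lemma nome_nonzero [simp]: "nome \<noteq> 0"
  by (simp add: nome_def)

lemma norm_nome_less_1: "norm nome < 1"
  using Im_pos by (simp add: nome_def)

text \<open>The part with n >= 0 of the bilateral series of \<open>nome ^ (n ^ 2) * x ^ n\<close>;
  as a power series it is entire.\<close>

definition half_theta :: "complex \<Rightarrow> complex" where
  "half_theta x = (\<Sum>n. nome ^ (n ^ 2) * x ^ n)"

lemma summable_half_theta: "summable (\<lambda>n. norm (nome ^ (n ^ 2) * x ^ n))"
proof (rule summable_norm_power_series_ratio[of _ "\<lambda>n. nome * (nome ^ n * nome ^ n)"])
  have "(\<lambda>n. nome ^ n) \<longlonglongrightarrow> 0"
    using norm_nome_less_1 by (rule LIMSEQ_power_zero)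
  then have "(\<lambda>n. nome * (nome ^ n * nome ^ n)) \<longlonglongrightarrow> nome * (0 * 0)"
    by (intro tendsto_mult tendsto_const)
  then show "(\<lambda>n. nome * (nome ^ n * nome ^ n)) \<longlonglongrightarrow> 0"
    by simp
  show "nome ^ ((Suc n) ^ 2) = nome * (nome ^ n * nome ^ n) * nome ^ (n ^ 2)" for n
    by (simp add: power2_eq_square power_add algebra_simps)
qed

lemma half_theta_sums: "(\<lambda>n. nome ^ (n ^ 2) * x ^ n) sums half_theta x"
  unfolding half_theta_def
  by (rule summable_sums[OF summable_norm_cancel[OF summable_half_theta]])

text \<open>The term n = 0 is split off, and (n + 1)^2 = n^2 + 2 n + 1 is used in the remaining
  ones.\<close>

lemma half_theta_rec: "half_theta x = 1 + nome * x * half_theta (nome ^ 2 * x)"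
proof -
  have "half_theta x = nome ^ (0 ^ 2) * x ^ 0 + (\<Sum>n. nome ^ ((Suc n) ^ 2) * x ^ Suc n)"
    unfolding half_theta_def
    using suminf_split_head[OF summable_norm_cancel[OF summable_half_theta[of x]]] by simp
  also have "(\<lambda>n. nome ^ ((Suc n) ^ 2) * x ^ Suc n)
      = (\<lambda>n. nome * x * (nome ^ (n ^ 2) * (nome ^ 2 * x) ^ n))"
    by (simp add: fun_eq_iff power_mult_distrib power_add power_mult [symmetric]
        power2_eq_square algebra_simps)
  also have "(\<Sum>n. nome * x * (nome ^ (n ^ 2) * (nome ^ 2 * x) ^ n))
      = nome * x * half_theta (nome ^ 2 * x)"
    by (rule sums_unique[symmetric, OF sums_mult[OF half_theta_sums]])
  finally show ?thesis by simp
qed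

lemma half_theta_holomorphic: "half_theta holomorphic_on UNIV"
  unfolding half_theta_def [abs_def]
  by (intro holomorphic_power_series_UNIV summable_half_theta)

lemma half_theta_0 [simp]: "half_theta 0 = 1"
  by (subst half_theta_rec) simp

text \<open>The bilateral theta series for \<open>x \<noteq> 0\<close>; the summand -1 removes the
  second copy of the term n = 0, which both halves contain.\<close>

definition laurent_theta :: "complex \<Rightarrow> complex" where
  "laurent_theta x = half_theta x + half_theta (1 / x) - 1"

text \<open>This is an index shift by one in the bilateral series: the recursion moves one term out
  of one half and into the other.\<close>

lemma laurent_theta_shift:
  assumes "x \<noteq> 0"
  shows "laurent_theta (nome ^ 2 * x) = laurent_theta x / (nome * x)"
proof -
  have "half_theta (1 / (nome ^ 2 * x)) = 1 + 1 / (nome * x) * half_theta (1 / x)"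
    by (subst half_theta_rec) (use assms in \<open>simp add: field_simps power2_eq_square\<close>)
  moreover have "half_theta (nome ^ 2 * x) = (half_theta x - 1) / (nome * x)"
    using assms by (subst (2) half_theta_rec) simp
  ultimately show ?thesis
    using assms by (simp add: laurent_theta_def field_simps)
qed

text \<open>If the series vanished identically, \<open>half_theta x\<close> would equal
  \<open>1 - half_theta (1 / x)\<close> and so be bounded outside the unit disc as well as inside
  it. By Liouville's theorem it would be constant 1, and the recursion would give
  \<open>nome = 0\<close>.\<close>

lemma laurent_theta_nonzero: "\<exists>x. x \<noteq> 0 \<and> laurent_theta x \<noteq> 0"
proof (rule ccontr)
  assume *: "\<not> ?thesis"
  have refl: "half_theta x = 1 - half_theta (1 / x)" if "x \<noteq> 0" for x
    using * that by (auto simp: laurent_theta_def algebra_simps)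
  have "compact (half_theta ` cball 0 1)"
    by (intro compact_continuous_image holomorphic_on_imp_continuous_on
        holomorphic_on_subset[OF half_theta_holomorphic]) auto
  then obtain M where M: "\<And>x. norm x \<le> 1 \<Longrightarrow> norm (half_theta x) \<le> M"
    by (metis (no_types, opaque_lifting) bounded_iff compact_imp_bounded imageI mem_cball_0)
  have "norm (half_theta x) \<le> 1 + M" for x
  proof (cases "norm x \<le> 1")
    case False
    then have "norm (half_theta (1 / x)) \<le> M"
      by (intro M) (auto simp: norm_divide divide_le_eq)
    moreover have "x \<noteq> 0" using False by auto
    then have "norm (half_theta x) \<le> 1 + norm (half_theta (1 / x))"
      using norm_triangle_ineq4[of 1 "half_theta (1 / x)"] by (metis refl norm_one)
    ultimately show ?thesis by simp
  qed (use M[of x] in auto)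
  then have "bounded (range half_theta)"
    by (auto simp: bounded_iff)
  then have "half_theta constant_on UNIV"
    by (rule Liouville_theorem[OF half_theta_holomorphic])
  then have "half_theta x = half_theta 0" for x
    by (metis UNIV_I constant_on_def)
  then have const: "half_theta x = 1" for x by simp
  have "half_theta 1 = 1 + nome * 1 * half_theta (nome ^ 2 * 1)"
    by (rule half_theta_rec)
  then show False
    unfolding const by simp
qed

lemma qpow_half_square: "qpow \<tau> ((real n)\<^sup>2 / 2) = nome ^ (n ^ 2)"
  by (simp add: qpow_def nome_def mult_ac flip: exp_of_nat_mult)

lemma qpow_odd_square:
  "qpow \<tau> ((2 * real n + 1)\<^sup>2 / 8) = exp (\<i> * of_real pi * \<tau> / 4) * nome ^ (n ^ 2) * nome ^ n"
  by (simp add: qpow_def nome_def power2_eq_square algebra_simps add_divide_distrib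
        flip: exp_of_nat_mult exp_add)

text \<open>Twice the cosine is the sum of the n-th powers of w = exp (2 i z) and 1 / w, so each
  half of the Laurent series receives its terms with n >= 1.\<close>

lemma jtheta3_eq_laurent: "jtheta3 z \<tau> = laurent_theta (exp (2 * \<i> * z))"
proof -
  let ?w = "exp (2 * \<i> * z)"
  have tail: "(\<lambda>n. nome ^ ((Suc n) ^ 2) * x ^ Suc n) sums (half_theta x - 1)" for x
    using half_theta_sums[of x] by (subst sums_Suc_iff) simp
  have "2 * cos (2 * of_nat (Suc n) * z) = ?w ^ Suc n + (1 / ?w) ^ Suc n" for n
    unfolding cos_exp_eq exp_minus[symmetric] inverse_eq_divide[symmetric] exp_of_nat_mult[symmetric]
    by (simp add: mult_ac)
  then have summand: "2 * (qpow \<tau> ((real (Suc n))\<^sup>2 / 2) * cos (2 * of_nat (Suc n) * z))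
      = nome ^ ((Suc n) ^ 2) * ?w ^ Suc n + nome ^ ((Suc n) ^ 2) * (1 / ?w) ^ Suc n" for n
    unfolding qpow_half_square by (metis distrib_left mult.left_commute)
  have "(\<lambda>n. 2 * (qpow \<tau> ((real (Suc n))\<^sup>2 / 2) * cos (2 * of_nat (Suc n) * z)))
      sums ((half_theta ?w - 1) + (half_theta (1 / ?w) - 1))"
    unfolding summand by (intro sums_add tail)
  then have "(\<lambda>n. qpow \<tau> ((real (Suc n))\<^sup>2 / 2) * cos (2 * of_nat (Suc n) * z))
      sums (((half_theta ?w - 1) + (half_theta (1 / ?w) - 1)) / 2)"
    using sums_mult[where c = "1 / 2"] by fastforce
  then show ?thesis
    unfolding jtheta3_def laurent_theta_def by (simp add: sums_unique[symmetric] field_simps del: of_nat_Suc)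
qed

text \<open>Here (2 n + 1)^2 / 8 = 1/8 + (n^2 + n) / 2 yields the factor exp (i pi \<tau> / 4) and
  an additional \<open>nome ^ n\<close>, which goes with the sign into the argument.\<close>

lemma jtheta1_eq_laurent:
  "jtheta1 z \<tau> = - \<i> * exp (\<i> * of_real pi * \<tau> / 4 + \<i> * z) * laurent_theta (- nome * exp (2 * \<i> * z))"
proof -
  let ?w = "exp (\<i> * z)" and ?c = "exp (\<i> * of_real pi * \<tau> / 4)"
  have w2: "exp (2 * \<i> * z) = ?w ^ 2"
    by (simp add: mult_ac flip: exp_double)
  have "2 * sin ((2 * of_nat n + 1) * z) = - \<i> * (?w * (?w ^ 2) ^ n - 1 / ?w * (1 / ?w ^ 2) ^ n)" for n
    unfolding sin_exp_eq' exp_minus[symmetric] inverse_eq_divide[symmetric] w2[symmetric]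
      exp_of_nat_mult[symmetric] exp_add[symmetric]
    by (simp add: field_simps)
  then have summand: "2 * ((-1) ^ n * qpow \<tau> ((2 * real n + 1)\<^sup>2 / 8) * sin ((2 * of_nat n + 1) * z))
      = (- \<i> * ?c * ?w) * (nome ^ (n ^ 2) * (- nome * ?w ^ 2) ^ n)
        - (- \<i> * ?c * (1 / ?w)) * (nome ^ (n ^ 2) * (- nome * (1 / ?w ^ 2)) ^ n)" for n
  proof -
    assume *: "\<And>n. 2 * sin ((2 * of_nat n + 1) * z)
      = - \<i> * (?w * (?w ^ 2) ^ n - 1 / ?w * (1 / ?w ^ 2) ^ n)"
    have "2 * ((-1) ^ n * qpow \<tau> ((2 * real n + 1)\<^sup>2 / 8) * sin ((2 * of_nat n + 1) * z))
      = ((-1) ^ n * ?c * nome ^ (n ^ 2) * nome ^ n) * (2 * sin ((2 * of_nat n + 1) * z))"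
      unfolding qpow_odd_square by (simp only: mult_ac)
    also have "\<dots> = ((-1) ^ n * nome ^ n * ?c * nome ^ (n ^ 2))
        * (- \<i> * (?w * (?w ^ 2) ^ n - 1 / ?w * (1 / ?w ^ 2) ^ n))"
      unfolding * by (simp only: mult_ac)
    also have "(-1) ^ n * nome ^ n = (- nome) ^ n"
      by (simp flip: power_mult_distrib)
    finally show ?thesis
      unfolding power_mult_distrib by (simp add: algebra_simps)
  qed
  have "(\<lambda>n. 2 * ((-1) ^ n * qpow \<tau> ((2 * real n + 1)\<^sup>2 / 8) * sin ((2 * of_nat n + 1) * z)))
      sums ((- \<i> * ?c * ?w) * half_theta (- nome * ?w ^ 2)
          - (- \<i> * ?c * (1 / ?w)) * half_theta (- nome * (1 / ?w ^ 2)))"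
    unfolding summand by (intro sums_diff sums_mult half_theta_sums)
  then have "(\<lambda>n. (-1) ^ n * qpow \<tau> ((2 * real n + 1)\<^sup>2 / 8) * sin ((2 * of_nat n + 1) * z))
      sums (((- \<i> * ?c * ?w) * half_theta (- nome * ?w ^ 2)
          - (- \<i> * ?c * (1 / ?w)) * half_theta (- nome * (1 / ?w ^ 2))) / 2)"
    using sums_mult[where c = "1 / 2"] by fastforce
  then have eq: "jtheta1 z \<tau> = (- \<i> * ?c * ?w) * half_theta (- nome * ?w ^ 2)
          - (- \<i> * ?c * (1 / ?w)) * half_theta (- nome * (1 / ?w ^ 2))"
    unfolding jtheta1_def by (simp add: sums_unique[symmetric])
  \<comment> \<open>The negative exponentials of the sine belong to the indices -n - 1 with n >= 0;
    one use of the recursion matches them with the half series in \<open>1 / x\<close>, which starts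
    at index 0.\<close>
  have "half_theta (1 / (- nome * ?w ^ 2))
      = 1 + nome * (1 / (- nome * ?w ^ 2)) * half_theta (nome ^ 2 * (1 / (- nome * ?w ^ 2)))"
    by (rule half_theta_rec)
  also have "nome ^ 2 * (1 / (- nome * ?w ^ 2)) = - nome * (1 / ?w ^ 2)"
    by (simp add: power2_eq_square)
  finally have "laurent_theta (- nome * ?w ^ 2)
      = half_theta (- nome * ?w ^ 2) - 1 / ?w ^ 2 * half_theta (- nome * (1 / ?w ^ 2))"
    by (simp add: laurent_theta_def)
  then show ?thesis
    unfolding eq w2 exp_add by (simp only: right_diff_distrib) (simp add: power2_eq_square)
qed

section \<open>Relations among the theta functions and their quasi-periods\<close>

lemma jtheta2_eq_jtheta1: "jtheta2 z \<tau> = jtheta1 (z + of_real pi / 2) \<tau>"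
proof -
  have "sin ((2 * of_nat n + 1) * (z + of_real pi / 2)) = (-1) ^ n * cos ((2 * of_nat n + 1) * z)" for n
  proof -
    have "(2 * of_nat n + 1) * (z + of_real pi / 2)
        = ((2 * of_nat n + 1) * z + of_real (of_nat n * pi)) + complex_of_real pi / 2"
      by (simp add: algebra_simps add_divide_distrib)
    then show ?thesis
      by (simp add: sin_add cos_add cos_of_real[symmetric] sin_of_real[symmetric] del: of_real_mult)
        (simp add: cos_of_real sin_of_real)
  qed
  then have "(-1) ^ n * c * sin ((2 * of_nat n + 1) * (z + of_real pi / 2))
      = c * cos ((2 * of_nat n + 1) * z)" for n and c :: complex
    by (simp add: left_right_inverse_power)
  then show ?thesis
    unfolding jtheta1_def jtheta2_def by presburger
qed

lemma jtheta4_eq_jtheta3: "jtheta4 z \<tau> = jtheta3 (z + of_real pi / 2) \<tau>"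
proof -
  have "cos (2 * of_nat (Suc n) * (z + of_real pi / 2)) = (-1) ^ Suc n * cos (2 * of_nat (Suc n) * z)" for n
  proof -
    have "2 * of_nat (Suc n) * (z + of_real pi / 2)
        = 2 * of_nat (Suc n) * z + complex_of_real (of_nat (Suc n) * pi)"
      by (simp add: algebra_simps)
    then show ?thesis
      by (simp only: cos_add cos_of_real sin_of_real) (simp del: of_nat_Suc)
  qed
  then show ?thesis
    unfolding jtheta3_def jtheta4_def by (simp add: mult_ac)
qed

text \<open>With w = exp (2 i z), the half period changes the argument \<open>- nome * w\<close> of
  the Laurent series into \<open>nome ^ 2 * w\<close>, and one quasi-periodic shift leads back to
  w.\<close>

lemma jtheta3_eq_jtheta1:
  "jtheta3 z \<tau> = exp (\<i> * of_real pi * \<tau> / 4 + \<i> * z) * jtheta1 (z + (of_real pi + of_real pi * \<tau>) / 2) \<tau>"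
proof -
  let ?w = "exp (2 * \<i> * z)"
  have 1: "exp (2 * \<i> * (z + (of_real pi + of_real pi * \<tau>) / 2)) = - nome * ?w"
  proof -
    have "2 * \<i> * (z + (of_real pi + of_real pi * \<tau>) / 2)
        = \<i> * of_real pi + \<i> * of_real pi * \<tau> + 2 * \<i> * z"
      by (simp add: field_simps)
    then show ?thesis
      by (simp only: exp_add nome_def) simp
  qed
  have 2: "exp (\<i> * of_real pi * \<tau> / 4 + \<i> * z)
      * exp (\<i> * of_real pi * \<tau> / 4 + \<i> * (z + (of_real pi + of_real pi * \<tau>) / 2))
      = \<i> * (nome * ?w)"
  proof -
    have "exp (\<i> * of_real pi * \<tau> / 4 + \<i> * z)
      * exp (\<i> * of_real pi * \<tau> / 4 + \<i> * (z + (of_real pi + of_real pi * \<tau>) / 2))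
      = exp (\<i> * (of_real pi / 2)) * (nome * ?w)"
      unfolding nome_def exp_add[symmetric] by (rule arg_cong[of _ _ exp]) (simp add: field_simps)
    then show ?thesis
      using cis_pi_half by (simp add: cis_conv_exp)
  qed
  have "exp (\<i> * of_real pi * \<tau> / 4 + \<i> * z) * jtheta1 (z + (of_real pi + of_real pi * \<tau>) / 2) \<tau>
     = - \<i> * (\<i> * (nome * ?w)) * laurent_theta (nome ^ 2 * ?w)"
    unfolding jtheta1_eq_laurent 1 2[symmetric] by (simp add: power2_eq_square mult_ac)
  then show ?thesis
    by (simp add: laurent_theta_shift jtheta3_eq_laurent)
qed

lemma jtheta1_holomorphic: "(\<lambda>z. jtheta1 z \<tau>) holomorphic_on UNIV"
  unfolding jtheta1_eq_laurent laurent_theta_def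
  by (intro holomorphic_intros
      holomorphic_on_compose_gen[OF _ half_theta_holomorphic, unfolded o_def]) auto

lemma jtheta1_0 [simp]: "jtheta1 0 \<tau> = 0"
  by (simp add: jtheta1_def)

lemma jtheta1_not_identically_zero: "\<exists>z. jtheta1 z \<tau> \<noteq> 0"
proof -
  obtain x where x: "x \<noteq> 0" "laurent_theta x \<noteq> 0"
    using laurent_theta_nonzero by blast
  \<comment> \<open>A logarithm solves \<open>- nome * exp (2 * \<i> * z) = x\<close> for
    \<open>z\<close>.\<close>
  have "exp (2 * \<i> * (Ln (- x / nome) / (2 * \<i>))) = - x / nome"
    using x by simp
  then have "jtheta1 (Ln (- x / nome) / (2 * \<i>)) \<tau> \<noteq> 0"
    using x unfolding jtheta1_eq_laurent by simp
  then show ?thesis ..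
qed

lemma jtheta1_plus_pi: "jtheta1 (z + of_real pi) \<tau> = - jtheta1 z \<tau>"
proof -
  have "exp (2 * \<i> * (z + of_real pi)) = exp (2 * \<i> * z)"
    by (simp add: algebra_simps exp_add)
  then show ?thesis
    unfolding jtheta1_eq_laurent by (simp add: distrib_left exp_add)
qed

lemma jtheta1_plus_pi_tau:
  "jtheta1 (z + of_real pi * \<tau>) \<tau> = - exp (- (\<i> * of_real pi * \<tau> + 2 * \<i> * z)) * jtheta1 z \<tau>"
proof -
  have 1: "- nome * exp (2 * \<i> * (z + of_real pi * \<tau>)) = nome ^ 2 * (- nome * exp (2 * \<i> * z))"
    by (simp add: nome_def algebra_simps power2_eq_square flip: exp_add)
  have 2: "exp (\<i> * of_real pi * \<tau> / 4 + \<i> * (z + of_real pi * \<tau>))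
      = exp (\<i> * of_real pi * \<tau> / 4 + \<i> * z) * nome"
    unfolding nome_def exp_add[symmetric] by (rule arg_cong[of _ _ exp]) (simp add: algebra_simps)
  have 3: "exp (- (\<i> * of_real pi * \<tau> + 2 * \<i> * z)) = 1 / (nome * exp (2 * \<i> * z))"
    unfolding exp_minus exp_add nome_def by (rule inverse_eq_divide)
  show ?thesis
    unfolding jtheta1_eq_laurent 1 2 3
    by (subst laurent_theta_shift) (simp_all add: field_simps)
qed

subsection \<open>The zeros of theta functions\<close>

lemma norm_nome_sq_less_1: "norm (nome ^ 2) < 1"
  using norm_nome_less_1 by (simp add: norm_power power_less_one_iff)

lemma nome_sq_power_neq_1: "(nome ^ 2) ^ Suc n \<noteq> 1"
proof
  assume "(nome ^ 2) ^ Suc n = 1"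
  then have "norm (nome ^ 2) ^ Suc n = 1"
    by (metis norm_one norm_power)
  then show False
    using norm_nome_sq_less_1 power_Suc_less_one[of "norm (nome ^ 2)" n] by simp
qed

text \<open>The coefficients of Euler's expansion of the product of \<open>1 - q\<^sup>n x\<close> over all \<open>n \<ge> 0\<close>.\<close>

definition euler_coeff :: "nat \<Rightarrow> complex" where
  "euler_coeff n = (\<Prod>k<n. - ((nome ^ 2) ^ k) / (1 - (nome ^ 2) ^ Suc k))"

lemma euler_coeff_Suc:
  "euler_coeff (Suc n) = - ((nome ^ 2) ^ n) / (1 - (nome ^ 2) ^ Suc n) * euler_coeff n"
  by (simp add: euler_coeff_def)

text \<open>The series form makes the function entire at once; its product structure enters through
  \<open>euler_prod_rec\<close> only.\<close>

definition euler_prod :: "complex \<Rightarrow> complex" where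
  "euler_prod x = (\<Sum>n. euler_coeff n * x ^ n)"

lemma summable_euler: "summable (\<lambda>n. norm (euler_coeff n * x ^ n))"
proof (rule summable_norm_power_series_ratio)
  show "euler_coeff (Suc n) = - ((nome ^ 2) ^ n) / (1 - (nome ^ 2) ^ Suc n) * euler_coeff n" for n
    by (rule euler_coeff_Suc)
  have "(\<lambda>n. (nome ^ 2) ^ n) \<longlonglongrightarrow> 0"
    using norm_nome_sq_less_1 by (rule LIMSEQ_power_zero)
  from this and this[THEN LIMSEQ_Suc]
  have "(\<lambda>n. - ((nome ^ 2) ^ n) / (1 - (nome ^ 2) ^ Suc n)) \<longlonglongrightarrow> - 0 / (1 - 0)"
    by (intro tendsto_divide tendsto_minus tendsto_diff tendsto_const) simp_all
  then show "(\<lambda>n. - ((nome ^ 2) ^ n) / (1 - (nome ^ 2) ^ Suc n)) \<longlonglongrightarrow> 0"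
    by simp
qed

lemma euler_prod_sums: "(\<lambda>n. euler_coeff n * x ^ n) sums euler_prod x"
  unfolding euler_prod_def
  by (rule summable_sums[OF summable_norm_cancel[OF summable_euler]])

lemma euler_prod_holomorphic: "euler_prod holomorphic_on UNIV"
  unfolding euler_prod_def [abs_def]
  by (intro holomorphic_power_series_UNIV summable_euler)

lemma euler_prod_0 [simp]: "euler_prod 0 = 1"
  using powser_zero[of euler_coeff] by (simp add: euler_prod_def euler_coeff_def)

text \<open>The first factor of the product is split off. With q = \<open>nome ^ 2\<close> and
  coefficients a(n) this amounts to a(n + 1) (1 - q^(n + 1)) = - q^n a(n).\<close>

lemma euler_prod_rec: "euler_prod x = (1 - x) * euler_prod (nome ^ 2 * x)"
proof -
  let ?q = "nome ^ 2"
  have "(\<lambda>n. euler_coeff n * x ^ n - euler_coeff n * (?q * x) ^ n)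
      sums (euler_prod x - euler_prod (?q * x))"
    by (intro sums_diff euler_prod_sums)
  then have 1: "(\<lambda>n. euler_coeff (Suc n) * x ^ Suc n - euler_coeff (Suc n) * (?q * x) ^ Suc n)
      sums (euler_prod x - euler_prod (?q * x))"
    by (subst sums_Suc_iff) simp
  have "euler_coeff (Suc n) * x ^ Suc n - euler_coeff (Suc n) * (?q * x) ^ Suc n
      = - x * (euler_coeff n * (?q * x) ^ n)" for n
  proof -
    have "euler_coeff (Suc n) * x ^ Suc n - euler_coeff (Suc n) * (?q * x) ^ Suc n
        = (euler_coeff (Suc n) * (1 - ?q ^ Suc n)) * x ^ Suc n"
      unfolding power_mult_distrib by (simp only: algebra_simps mult_1_left)
    also have "euler_coeff (Suc n) * (1 - ?q ^ Suc n) = - (?q ^ n) * euler_coeff n"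
      using nome_sq_power_neq_1[of n] by (subst euler_coeff_Suc) (simp del: power_Suc)
    finally show ?thesis
      unfolding power_mult_distrib by simp
  qed
  with 1 have "(\<lambda>n. - x * (euler_coeff n * (?q * x) ^ n)) sums (euler_prod x - euler_prod (?q * x))"
    by simp
  from sums_unique2[OF this sums_mult[OF euler_prod_sums]]
  show ?thesis by (simp add: algebra_simps)
qed

text \<open>If no factor vanished at \<open>x\<close>, the recursion would carry the zero along
  \<open>(nome ^ 2) ^ n * x\<close>, which tends to 0, contrary to continuity and the value 1
  there.\<close>

lemma euler_prod_eq_0D:
  assumes "euler_prod x = 0"
  shows "\<exists>n. (nome ^ 2) ^ n * x = 1"
proof (rule ccontr)
  assume *: "\<not> ?thesis"
  have "euler_prod ((nome ^ 2) ^ n * x) = 0" for n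
  proof (induction n)
    case (Suc n)
    then show ?case
      using euler_prod_rec[of "(nome ^ 2) ^ n * x"] * by (simp add: mult.assoc)
  qed (use assms in simp)
  moreover have "(\<lambda>n. euler_prod ((nome ^ 2) ^ n * x)) \<longlonglongrightarrow> euler_prod 0"
  proof (rule continuous_on_tendsto_compose[of UNIV euler_prod])
    show "continuous_on UNIV euler_prod"
      by (rule holomorphic_on_imp_continuous_on[OF euler_prod_holomorphic])
    show "(\<lambda>n. (nome ^ 2) ^ n * x) \<longlonglongrightarrow> 0"
      by (rule tendsto_mult_left_zero[OF LIMSEQ_power_zero[OF norm_nome_sq_less_1]])
  qed auto
  ultimately show False
    by (simp add: LIMSEQ_const_iff)
qed

section \<open>The period lattice and a product that vanishes on it\<close>

definition lattice :: "complex set" where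
  "lattice = {of_int m * of_real pi + of_int n * (of_real pi * \<tau>) | m n. True}"

lemma latticeI [intro]: "of_int m * of_real pi + of_int n * (of_real pi * \<tau>) \<in> lattice"
  by (auto simp: lattice_def)

lemma exp_in_nome_powers_imp_lattice:
  assumes "exp (2 * \<i> * z) = exp (2 * \<i> * of_real pi * of_int n * \<tau>)"
  shows "z \<in> lattice"
proof -
  obtain m :: int where
    "2 * \<i> * z = 2 * \<i> * of_real pi * of_int n * \<tau> + of_int (2 * m) * of_real pi * \<i>"
    using assms unfolding exp_eq by auto
  then have "(2 * \<i>) * z = (2 * \<i>) * (of_int m * of_real pi + of_int n * (of_real pi * \<tau>))"
    by (simp add: algebra_simps)
  then have "z = of_int m * of_real pi + of_int n * (of_real pi * \<tau>)"
    by (subst (asm) mult_left_cancel) auto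
  then show ?thesis by auto
qed

lemma nome_sq_power: "(nome ^ 2) ^ n = exp (2 * \<i> * of_real pi * of_nat n * \<tau>)"
  by (simp add: nome_def mult_ac flip: exp_of_nat_mult)

text \<open>Jacobi's triple product for \<open>jtheta1\<close> up to a constant: the prefactor and
  the first factor of the first product combine to -2 i sin z, and the remaining factors are those
  with n >= 1.\<close>

definition theta_prod :: "complex \<Rightarrow> complex" where
  "theta_prod z = exp (- (\<i> * z)) * euler_prod (exp (2 * \<i> * z))
      * euler_prod (nome ^ 2 * exp (- (2 * \<i> * z)))"

lemma theta_prod_holomorphic: "theta_prod holomorphic_on UNIV"
  unfolding theta_prod_def [abs_def]
  by (intro holomorphic_intros
      holomorphic_on_compose_gen[OF _ euler_prod_holomorphic, unfolded o_def]) auto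

lemma theta_prod_0 [simp]: "theta_prod 0 = 0"
  using euler_prod_rec[of 1] by (simp add: theta_prod_def)

lemma theta_prod_eq_0D:
  assumes "theta_prod z = 0"
  shows "z \<in> lattice"
proof -
  consider "euler_prod (exp (2 * \<i> * z)) = 0" | "euler_prod (nome ^ 2 * exp (- (2 * \<i> * z))) = 0"
    using assms by (auto simp: theta_prod_def)
  then show ?thesis
  proof cases
    case 1
    from euler_prod_eq_0D[OF this] obtain n where "(nome ^ 2) ^ n * exp (2 * \<i> * z) = 1"
      by auto
    then have "exp (2 * \<i> * z) = exp (- (2 * \<i> * of_real pi * of_nat n * \<tau>))"
      unfolding nome_sq_power exp_minus by (metis inverse_unique)
    then show ?thesis
      by (intro exp_in_nome_powers_imp_lattice[of z "- int n"]) simp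
  next
    case 2
    from euler_prod_eq_0D[OF this]
    obtain n where "(nome ^ 2) ^ n * (nome ^ 2 * exp (- (2 * \<i> * z))) = 1"
      by auto
    then have "(nome ^ 2) ^ Suc n * exp (- (2 * \<i> * z)) = 1"
      by (simp add: mult_ac)
    then have "exp (2 * \<i> * z) = exp (2 * \<i> * of_real pi * of_nat (Suc n) * \<tau>)"
      unfolding nome_sq_power exp_minus by (metis inverse_inverse_eq inverse_unique mult.commute)
    then show ?thesis
      by (intro exp_in_nome_powers_imp_lattice[of z "int (Suc n)"]) simp
  qed
qed

lemma theta_prod_plus_pi: "theta_prod (z + of_real pi) = - theta_prod z"
proof -
  have "exp (2 * \<i> * (z + of_real pi)) = exp (2 * \<i> * z)"
    by (simp add: algebra_simps exp_add)
  moreover have "exp (- (\<i> * (z + of_real pi))) = - exp (- (\<i> * z))"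
    by (simp add: algebra_simps exp_diff exp_minus inverse_eq_divide exp_add)
  ultimately show ?thesis
    unfolding theta_prod_def exp_minus[of "2 * _ * _"] by simp
qed

text \<open>With w = exp (2 i z), the shift removes 1 - w from the first product and adds 1 - 1 / w
  to the second. The quotient of the two is - 1 / w, which with the change of the exponential
  prefactor gives the multiplier.\<close>

lemma theta_prod_plus_pi_tau:
  "theta_prod (z + of_real pi * \<tau>) = - exp (- (\<i> * of_real pi * \<tau> + 2 * \<i> * z)) * theta_prod z"
proof -
  let ?w = "exp (2 * \<i> * z)" and ?v = "exp (- (2 * \<i> * z))"
  have wv: "?w * ?v = 1" by (simp flip: exp_add)
  have 1: "exp (2 * \<i> * (z + of_real pi * \<tau>)) = nome ^ 2 * ?w"
    by (simp add: nome_def algebra_simps power2_eq_square flip: exp_add)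
  have "nome ^ 2 * exp (- (2 * \<i> * (z + of_real pi * \<tau>))) = ?v"
    by (simp add: nome_def algebra_simps power2_eq_square flip: exp_add)
  then have "theta_prod (z + of_real pi * \<tau>)
      = exp (- (\<i> * (z + of_real pi * \<tau>))) * euler_prod (nome ^ 2 * ?w) * euler_prod ?v"
    by (simp only: theta_prod_def 1)
  also have "\<dots> = exp (- (\<i> * (z + of_real pi * \<tau>))) * euler_prod (nome ^ 2 * ?w)
      * ((1 - ?v) * euler_prod (nome ^ 2 * ?v))"
    using euler_prod_rec[of ?v] by simp
  also have "1 - ?v = - (?v * (1 - ?w))"
    using wv by (simp add: algebra_simps)
  also have "exp (- (\<i> * (z + of_real pi * \<tau>))) = exp (- (\<i> * of_real pi * \<tau>)) * exp (- (\<i> * z))"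
    by (simp add: algebra_simps flip: exp_add)
  also have "exp (- (\<i> * of_real pi * \<tau>)) * exp (- (\<i> * z)) * euler_prod (nome ^ 2 * ?w)
      * (- (?v * (1 - ?w)) * euler_prod (nome ^ 2 * ?v))
     = - (exp (- (\<i> * of_real pi * \<tau>)) * ?v) * (exp (- (\<i> * z))
        * ((1 - ?w) * euler_prod (nome ^ 2 * ?w)) * euler_prod (nome ^ 2 * ?v))"
    by (simp only: mult_minus_left mult_minus_right mult_ac)
  also have "\<dots> = - (exp (- (\<i> * of_real pi * \<tau>)) * ?v) * theta_prod z"
    unfolding theta_prod_def using euler_prod_rec[of ?w] by simp
  also have "exp (- (\<i> * of_real pi * \<tau>)) * ?v = exp (- (\<i> * of_real pi * \<tau> + 2 * \<i> * z))"
    by (simp flip: exp_add)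
  finally show ?thesis .
qed

text \<open>Multiplied by an exponential, \<open>T\<close> has period pi; multiplied by a Gaussian,
  it has period pi \<tau>. This replaces an induction on multipliers. \<open>T\<close> is arbitrary
  because the lemma serves both \<open>jtheta1\<close> and \<open>theta_prod\<close>.\<close>

lemma quasiperiodic_lattice_shift:
  assumes pi: "\<And>z. T (z + of_real pi) = - T z"
    and tau: "\<And>z. T (z + of_real pi * \<tau>) = - exp (- (\<i> * of_real pi * \<tau> + 2 * \<i> * z)) * T z"
  shows "T (z + (of_int m * of_real pi + of_int n * (of_real pi * \<tau>)))
      = exp (- (\<i> * of_real pi * of_int m + \<i> * of_real pi * of_int n
            + \<i> * of_real pi * \<tau> * (of_int n)\<^sup>2 + 2 * \<i> * of_int n * z)) * T z"
proof -
  have nz: "\<tau> \<noteq> 0" using Im_pos by auto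
  define F where "F = (\<lambda>z. T z * exp (\<i> * z))"
  define G where "G = (\<lambda>z. T z * exp (\<i> * z\<^sup>2 / (of_real pi * \<tau>) + \<i> * z / \<tau>))"
  have F: "F (z + of_real pi) = F z" for z
    by (simp add: F_def pi distrib_left exp_add)
  have G: "G (z + of_real pi * \<tau>) = G z" for z
  proof -
    have "\<i> * (z + of_real pi * \<tau>)\<^sup>2 / (of_real pi * \<tau>) + \<i> * (z + of_real pi * \<tau>) / \<tau>
        = (\<i> * z\<^sup>2 / (of_real pi * \<tau>) + \<i> * z / \<tau>) + (\<i> * of_real pi * \<tau> + 2 * \<i> * z) + \<i> * of_real pi"
      using nz by (simp add: field_simps power2_eq_square)
    then show ?thesis
      unfolding G_def tau by (simp only: exp_add exp_minus) (simp add: field_simps)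
  qed
  let ?a = "of_int n * (of_real pi * \<tau>)"
  have "T (z + ?a) * exp (\<i> * (z + ?a)\<^sup>2 / (of_real pi * \<tau>) + \<i> * (z + ?a) / \<tau>)
      = T z * exp (\<i> * z\<^sup>2 / (of_real pi * \<tau>) + \<i> * z / \<tau>)"
    using periodic_of_int[where F = G, OF G, of z n] by (simp add: G_def)
  also have "\<i> * (z + ?a)\<^sup>2 / (of_real pi * \<tau>) + \<i> * (z + ?a) / \<tau>
      = (\<i> * z\<^sup>2 / (of_real pi * \<tau>) + \<i> * z / \<tau>) + (\<i> * of_real pi * of_int n
            + \<i> * of_real pi * \<tau> * (of_int n)\<^sup>2 + 2 * \<i> * of_int n * z)"
    using nz by (simp add: field_simps power2_eq_square)
  finally have 1: "T (z + ?a) = exp (- (\<i> * of_real pi * of_int n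
            + \<i> * of_real pi * \<tau> * (of_int n)\<^sup>2 + 2 * \<i> * of_int n * z)) * T z"
    unfolding exp_add[of "_ + \<i> * z / \<tau>"] exp_minus
    by (simp add: field_simps)
  have "T (z + ?a + of_int m * of_real pi) * exp (\<i> * (z + ?a + of_int m * of_real pi))
      = T (z + ?a) * exp (\<i> * (z + ?a))"
    using periodic_of_int[where F = F, OF F, of "z + ?a" m] by (simp add: F_def)
  then have "T (z + ?a + of_int m * of_real pi) = exp (- (\<i> * of_real pi * of_int m)) * T (z + ?a)"
    by (simp add: distrib_left exp_add exp_minus field_simps)
  then show ?thesis
    unfolding 1 by (simp add: add_ac mult.assoc[symmetric] flip: exp_add)
qed

lemma quasiperiodic_zero_lattice:
  assumes "\<And>z. T (z + of_real pi) = - T z"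
    and "\<And>z. T (z + of_real pi * \<tau>) = - exp (- (\<i> * of_real pi * \<tau> + 2 * \<i> * z)) * T z"
    and "T 0 = 0" "\<omega> \<in> lattice"
  shows "T \<omega> = 0"
proof -
  obtain m n where "\<omega> = of_int m * of_real pi + of_int n * (of_real pi * \<tau>)"
    using assms(4) by (auto simp: lattice_def)
  then show ?thesis
    using quasiperiodic_lattice_shift[of T 0 m n, OF assms(1,2)] assms(3) by simp
qed

text \<open>Near 0 the product is -2 i sin z times a function that does not vanish at 0, which gives
  the derivative there; quasi-periodicity carries the result to every lattice point with a nonzero
  factor.\<close>

lemma theta_prod_simple_zero:
  assumes "theta_prod z = 0"
  shows "deriv theta_prod z \<noteq> 0"
proof -
  define N where "N = (\<lambda>z. euler_prod (nome ^ 2 * exp (2 * \<i> * z))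
      * euler_prod (nome ^ 2 * exp (- (2 * \<i> * z))))"
  have eq: "theta_prod z = (exp (- (\<i> * z)) - exp (\<i> * z)) * N z" for z
  proof -
    have "exp (- (\<i> * z)) * (1 - exp (2 * \<i> * z)) = exp (- (\<i> * z)) - exp (\<i> * z)"
      by (simp add: algebra_simps flip: exp_add)
    then show ?thesis
      unfolding theta_prod_def N_def
      using euler_prod_rec[of "exp (2 * \<i> * z)"] by (simp add: mult.assoc[symmetric])
  qed
  have "euler_prod (nome ^ 2) \<noteq> 0"
    using euler_prod_eq_0D[of "nome ^ 2"] nome_sq_power_neq_1 by (auto simp: mult.commute)
  then have "N 0 \<noteq> 0" by (simp add: N_def)
  have "N holomorphic_on UNIV"
    unfolding N_def
    by (intro holomorphic_intros
        holomorphic_on_compose_gen[OF _ euler_prod_holomorphic, unfolded o_def]) auto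
  then have N': "(N has_field_derivative deriv N 0) (at 0)"
    by (rule holomorphic_derivI) auto
  have d0: "(theta_prod has_field_derivative - 2 * \<i> * N 0) (at 0)"
    unfolding eq [abs_def] by (rule derivative_eq_intros N' refl | simp)+
  obtain m n where \<omega>: "z = of_int m * of_real pi + of_int n * (of_real pi * \<tau>)"
    using theta_prod_eq_0D[OF assms] by (auto simp: lattice_def)
  define e where "e = (\<lambda>u. exp (- (\<i> * of_real pi * of_int m + \<i> * of_real pi * of_int n
            + \<i> * of_real pi * \<tau> * (of_int n)\<^sup>2 + 2 * \<i> * of_int n * u)))"
  have shift: "theta_prod (u + z) = e u * theta_prod u" for u
    unfolding e_def \<omega>
    by (rule quasiperiodic_lattice_shift[OF theta_prod_plus_pi theta_prod_plus_pi_tau])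
  have "e holomorphic_on UNIV"
    unfolding e_def by (intro holomorphic_intros)
  then have e': "(e has_field_derivative deriv e 0) (at 0)"
    by (rule holomorphic_derivI) auto
  \<comment> \<open>The term with the derivative of \<open>e\<close> drops out since
    \<open>theta_prod 0 = 0\<close>.\<close>
  have "((\<lambda>u. theta_prod (u + z)) has_field_derivative e 0 * (- 2 * \<i> * N 0)) (at 0)"
    unfolding shift using DERIV_mult[OF e' d0] by (simp add: mult_ac)
  then have "(theta_prod has_field_derivative e 0 * (- 2 * \<i> * N 0)) (at z)"
    by (simp add: DERIV_shift flip: DERIV_shift[of theta_prod _ 0 z])
  then have "deriv theta_prod z = e 0 * (- 2 * \<i> * N 0)"
    by (rule DERIV_imp_deriv)
  then show ?thesis
    using \<open>N 0 \<noteq> 0\<close> by (simp add: e_def)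
qed

lemma theta_prod_not_identically_zero: "\<exists>z. theta_prod z \<noteq> 0"
proof (rule ccontr)
  assume "\<not> ?thesis"
  then have "theta_prod = (\<lambda>_. 0)" by auto
  then show False
    using theta_prod_simple_zero[of 0] by simp
qed

text \<open>The quotient is entire since the denominator has simple zeros at which
  \<open>jtheta1\<close> vanishes, and it has both periods because the multipliers agree; so it is
  constant. This determines the zeros of \<open>jtheta1\<close> and their order.\<close>

lemma jtheta1_eq_theta_prod: "\<exists>c. c \<noteq> 0 \<and> (\<forall>z. jtheta1 z \<tau> = c * theta_prod z)"
proof -
  have "jtheta1 z \<tau> = 0" if "theta_prod z = 0" for z
    using quasiperiodic_zero_lattice[of "\<lambda>z. jtheta1 z \<tau>", OF jtheta1_plus_pi jtheta1_plus_pi_tau]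
      theta_prod_eq_0D[OF that] by simp
  then obtain k where k: "k holomorphic_on UNIV" "\<And>z. jtheta1 z \<tau> = theta_prod z * k z"
    using entire_factor_simple_zeros[OF jtheta1_holomorphic theta_prod_holomorphic
        theta_prod_simple_zero] by metis
  obtain a where a: "theta_prod a \<noteq> 0"
    using theta_prod_not_identically_zero by blast
  have shift: "(\<lambda>z. k (z + w)) holomorphic_on UNIV" for w
    by (intro holomorphic_on_compose_gen[OF _ k(1), unfolded o_def] holomorphic_intros) auto
  note cancel = entire_mult_left_cancel[OF theta_prod_holomorphic _ k(1) a]
  have k1: "k (z + of_real pi) = k z" for z
  proof (rule cancel)
    show "theta_prod z * k (z + of_real pi) = theta_prod z * k z" for z
      using jtheta1_plus_pi[of z] by (simp add: k(2) theta_prod_plus_pi)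
  qed (rule shift)
  have k2: "k (z + of_real pi * \<tau>) = k z" for z
  proof (rule cancel)
    show "theta_prod z * k (z + of_real pi * \<tau>) = theta_prod z * k z" for z
      using jtheta1_plus_pi_tau[of z] by (simp add: k(2) theta_prod_plus_pi_tau)
  qed (rule shift)
  obtain c n where c: "\<And>z. k z = c * exp (2 * \<i> * of_int n * z)"
    and n: "c = 0 \<or> 1 = exp (2 * \<i> * of_real pi * of_int n * \<tau>)"
    using doubly_quasiperiodic_entire[of k 1] k(1) k1 k2 by auto
  have "c \<noteq> 0"
    using jtheta1_not_identically_zero c k(2) by auto
  \<comment> \<open>The multiplier 1 has norm 1, which excludes every \<open>n\<close> except
    0.\<close>
  with n have "norm (exp (2 * \<i> * of_real pi * of_int n * \<tau>)) = 1"
    by (metis norm_one)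
  then have "n = 0"
    using Im_pos by simp
  then show ?thesis
    using \<open>c \<noteq> 0\<close> c k(2) by (intro exI[of _ c]) simp
qed

lemma jtheta1_eq_0_iff: "jtheta1 z \<tau> = 0 \<longleftrightarrow> z \<in> lattice"
  using jtheta1_eq_theta_prod theta_prod_eq_0D[of z]
    quasiperiodic_zero_lattice[OF theta_prod_plus_pi theta_prod_plus_pi_tau, of z] by auto

lemma jtheta1_simple_zero:
  assumes "jtheta1 z \<tau> = 0"
  shows "deriv (\<lambda>z. jtheta1 z \<tau>) z \<noteq> 0"
proof -
  obtain c where c: "c \<noteq> 0" "\<And>z. jtheta1 z \<tau> = c * theta_prod z"
    using jtheta1_eq_theta_prod by auto
  have "theta_prod field_differentiable (at z)"
    using theta_prod_holomorphic holomorphic_on_imp_differentiable_at by blast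
  then show ?thesis
    using theta_prod_simple_zero[of z] assms c by (simp add: deriv_cmult)
qed

subsection \<open>A relation between the values at the half periods\<close>

text \<open>What remains of the interpolation identity for \<open>y = 0\<close>: the left-hand side
  is zero and the theta quotients are all 1.\<close>

lemma half_period_values_relation:
  assumes hol: "g holomorphic_on UNIV"
    and pi: "\<And>z. g (z + of_real pi) = g z"
    and tau: "\<And>z. g z = exp (4 * \<i> * of_real pi * \<tau> + 8 * \<i> * z) * g (z + of_real pi * \<tau>)"
  shows "g 0 - g (of_real pi / 2)
      + nome * g ((of_real pi + of_real pi * \<tau>) / 2) - nome * g (of_real pi * \<tau> / 2) = 0"
proof -
  let ?h = "of_real pi * \<tau> / 2"
  \<comment> \<open>Translation by half of pi \<tau>, with the exponential chosen so that applying
    it twice is the translation law of \<open>g\<close>.\<close>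
  define S where "S = (\<lambda>F z. exp (4 * \<i> * z) * nome * F (z + ?h))"
  have exp_4: "exp (4 * \<i> * (z + of_real pi / 2)) = exp (4 * \<i> * z)" for z
  proof -
    have "4 * \<i> * (z + of_real pi / 2) = 4 * \<i> * z + 2 * of_real pi * \<i>"
      by (simp add: algebra_simps)
    then show ?thesis by (simp add: exp_add)
  qed
  have h2: "z + ?h + ?h = z + of_real pi * \<tau>" for z
    by (simp add: field_simps)
  have SS: "S (S g) z = g z" for z
  proof -
    have "S (S g) z = exp (4 * \<i> * z) * nome * exp (4 * \<i> * (z + ?h)) * nome * g (z + of_real pi * \<tau>)"
      by (simp only: S_def h2 mult.assoc)
    also have "exp (4 * \<i> * z) * nome * exp (4 * \<i> * (z + ?h)) * nome
        = exp (4 * \<i> * of_real pi * \<tau> + 8 * \<i> * z)"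
      unfolding nome_def exp_add[symmetric] by (rule arg_cong[of _ _ exp]) (simp add: algebra_simps)
    finally show ?thesis using tau[of z] by simp
  qed
  \<comment> \<open>S is an involution on the space of such functions g.  The expression to be computed is
      u 0 - u (pi/2) for the S-odd part u of g, that is, half the value at 0 of v below.  All
      symmetries of v together force v = 0.\<close>
  define u where "u = (\<lambda>z. g z - S g z)"
  have Su: "S u z = - u z" for z
  proof -
    have "S u z = S g z - S (S g) z"
      unfolding S_def u_def by (simp add: algebra_simps)
    then show ?thesis by (simp add: SS u_def)
  qed
  have u_pi: "u (z + of_real pi) = u z" for z
    using exp_4[of z] exp_4[of "z + of_real pi / 2"] pi[of z] pi[of "z + ?h"]
    by (simp add: u_def S_def add_ac)
  \<comment> \<open>Twice the even part of \<open>u\<close>; reflection is compatible with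
    \<open>S\<close>.\<close>
  define e where "e = (\<lambda>z. u z + u (- z))"
  have e_pi: "e (z + of_real pi) = e z" for z
    using u_pi[of z] u_pi[of "- z - of_real pi"] by (simp add: e_def)
  have Se: "S e z = - e z" for z
  proof -
    have c: "(exp (4 * \<i> * z) * nome) * (exp (4 * \<i> * (- z - ?h)) * nome) = 1"
      unfolding nome_def exp_add[symmetric]
      by (subst exp_zero[symmetric], rule arg_cong[of _ _ exp]) (simp add: algebra_simps)
    have "exp (4 * \<i> * (- z - ?h)) * nome * u (- z) = - u (- z - ?h)"
      using Su[of "- z - ?h"] by (simp add: S_def)
    then have "(exp (4 * \<i> * z) * nome) * (exp (4 * \<i> * (- z - ?h)) * nome) * u (- z)
        = - ((exp (4 * \<i> * z) * nome) * u (- z - ?h))"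
      by (metis (no_types, lifting) mult.assoc mult_minus_right)
    then have "(exp (4 * \<i> * z) * nome) * u (- z - ?h) = - u (- z)"
      unfolding c by simp
    moreover have "(exp (4 * \<i> * z) * nome) * u (z + ?h) = - u z"
      using Su[of z] by (simp add: S_def)
    ultimately show ?thesis
      unfolding S_def e_def by (simp add: distrib_left minus_add_distrib)
  qed
  \<comment> \<open>Twice the part of \<open>e\<close> that changes sign under translation by pi /
    2.\<close>
  define v where "v = (\<lambda>z. e z - e (z + of_real pi / 2))"
  have v_half: "v (z + of_real pi / 2) = - v z" for z
    using e_pi[of z] by (simp add: v_def add.assoc)
  have v_even: "v (- z) = v z" for z
    using e_pi[of "z - of_real pi / 2"] by (simp add: v_def e_def add_ac)
  have v_tau: "v z = - (exp (4 * \<i> * z) * nome * v (z + ?h))" for z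
    using Se[of z] Se[of "z + of_real pi / 2"]
    unfolding S_def exp_4 v_def by (simp add: algebra_simps)
  have holv: "v holomorphic_on UNIV"
    unfolding v_def e_def u_def S_def
    by (intro holomorphic_intros holomorphic_on_compose_gen[OF _ hol, unfolded o_def]) auto
  \<comment> \<open>Halving the argument turns the translations by pi / 2 and pi \<tau> / 2 into
    full periods. The offset moves to the origin the zero of \<open>v\<close> at - pi / 4, which
    comes from evenness and the sign change under pi / 2.\<close>
  define W where "W = (\<lambda>z. v ((z - of_real pi / 2) / 2))"
  have holW: "W holomorphic_on UNIV"
    unfolding W_def
    by (intro holomorphic_intros holomorphic_on_compose_gen[OF _ holv, unfolded o_def]) auto
  have W_pi: "W (z + of_real pi) = - W z" for z
    using v_half[of "(z - of_real pi / 2) / 2"]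
    by (simp add: W_def add_divide_distrib diff_divide_distrib)
  have W_tau: "W (z + of_real pi * \<tau>) = exp (- (\<i> * of_real pi * \<tau> + 2 * \<i> * z)) * W z" for z
  proof -
    let ?s = "(z - of_real pi / 2) / 2"
    have 1: "exp (4 * \<i> * ?s) * nome = - exp (\<i> * of_real pi * \<tau> + 2 * \<i> * z)"
    proof -
      have "exp (4 * \<i> * ?s) * nome = exp ((\<i> * of_real pi * \<tau> + 2 * \<i> * z) - \<i> * of_real pi)"
        unfolding nome_def exp_add[symmetric] by (rule arg_cong[of _ _ exp]) (simp add: field_simps)
      then show ?thesis by (simp add: exp_diff)
    qed
    let ?a = "\<i> * of_real pi * \<tau> + 2 * \<i> * z"
    have "v ?s = exp ?a * v (?s + ?h)"
      using v_tau[of ?s] unfolding 1 by simp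
    then have "exp (- ?a) * v ?s = (exp (- ?a) * exp ?a) * v (?s + ?h)"
      by (simp only: mult.assoc)
    also have "exp (- ?a) * exp ?a = 1"
      by (simp flip: exp_add)
    also have "?s + ?h = (z + of_real pi * \<tau> - of_real pi / 2) / 2"
      by (simp add: field_simps)
    finally show ?thesis
      unfolding W_def by simp
  qed
  have W0: "W 0 = 0"
    using v_half[of "- (of_real pi / 4)"] v_even[of "of_real pi / 4"] by (simp add: W_def)
  have W_zero: "W z = 0" if "jtheta1 z \<tau> = 0" for z
  proof -
    have nz: "W (x + of_int m * of_real pi) = 0 \<longleftrightarrow> W x = 0" for x m
      using periodic_of_int[where F = "\<lambda>z. W z = 0" and w = "of_real pi"] W_pi by simp
    have nz': "W (x + of_int m * (of_real pi * \<tau>)) = 0 \<longleftrightarrow> W x = 0" for x m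
      using periodic_of_int[where F = "\<lambda>z. W z = 0" and w = "of_real pi * \<tau>"] W_tau by simp
    obtain m n where "z = 0 + of_int m * of_real pi + of_int n * (of_real pi * \<tau>)"
      using \<open>jtheta1 z \<tau> = 0\<close> unfolding jtheta1_eq_0_iff lattice_def by auto
    then show ?thesis
      using W0 nz nz' by metis
  qed
  obtain k where k: "k holomorphic_on UNIV" "\<And>z. W z = jtheta1 z \<tau> * k z"
    using entire_factor_simple_zeros[OF holW jtheta1_holomorphic jtheta1_simple_zero W_zero] by metis
  obtain a where a: "jtheta1 a \<tau> \<noteq> 0"
    using jtheta1_not_identically_zero by blast
  have shift: "(\<lambda>z. k (z + w)) holomorphic_on UNIV" for w
    by (intro holomorphic_on_compose_gen[OF _ k(1), unfolded o_def] holomorphic_intros) auto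
  have k1: "k (z + of_real pi) = k z" for z
  proof (rule entire_mult_left_cancel[OF jtheta1_holomorphic shift k(1) a])
    show "jtheta1 z \<tau> * k (z + of_real pi) = jtheta1 z \<tau> * k z" for z
      using W_pi[of z] by (simp add: k(2) jtheta1_plus_pi)
  qed
  \<comment> \<open>\<open>W\<close> and \<open>jtheta1\<close> have multipliers of opposite sign
    for pi \<tau>, hence the factor -1. It excludes every exponential: norm 1 forces
    \<open>n = 0\<close>, and then the multiplier would be 1.\<close>
  have k2: "k (z + of_real pi * \<tau>) = - 1 * k z" for z
  proof (rule entire_mult_left_cancel[OF jtheta1_holomorphic shift _ a])
    show "(\<lambda>z. - 1 * k z) holomorphic_on UNIV"
      by (intro holomorphic_intros k(1))
    show "jtheta1 z \<tau> * k (z + of_real pi * \<tau>) = jtheta1 z \<tau> * (- 1 * k z)" for z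
      using neg_mult_left_cancel[of "exp (- (\<i> * of_real pi * \<tau> + 2 * \<i> * z))" "jtheta1 z \<tau>"]
        W_tau[of z] by (simp add: k(2) jtheta1_plus_pi_tau)
  qed
  obtain c n where c: "\<And>z. k z = c * exp (2 * \<i> * of_int n * z)"
    and n: "c = 0 \<or> - 1 = exp (2 * \<i> * of_real pi * of_int n * \<tau>)"
    using doubly_quasiperiodic_entire[OF k(1) k1 k2] by auto
  have "c = 0"
  proof (rule ccontr)
    assume "c \<noteq> 0"
    with n have *: "exp (2 * \<i> * of_real pi * of_int n * \<tau>) = - 1" by simp
    then have "norm (exp (2 * \<i> * of_real pi * of_int n * \<tau>)) = 1"
      by simp
    then have "n = 0"
      using Im_pos by simp
    with * show False by simp
  qed
  then have "W (of_real pi / 2) = 0"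
    by (simp add: k(2) c)
  then have "v 0 = 0" by (simp add: W_def)
  then have "u 0 = u (of_real pi / 2)"
    using u_pi[of "- (of_real pi / 2)"] by (simp add: v_def e_def)
  then show ?thesis
    using exp_4[of 0] by (simp add: u_def S_def algebra_simps add_divide_distrib)
qed

subsection \<open>The interpolation identity\<close>

lemma lattice_add: "a \<in> lattice \<Longrightarrow> b \<in> lattice \<Longrightarrow> a + b \<in> lattice"
  unfolding lattice_def
proof safe
  fix m n m' n' :: int
  show "\<exists>k l. of_int m * of_real pi + of_int n * (of_real pi * \<tau>)
        + (of_int m' * of_real pi + of_int n' * (of_real pi * \<tau>))
      = of_int k * of_real pi + of_int l * (of_real pi * \<tau>) \<and> True"
    by (intro exI[of _ "m + m'"] exI[of _ "n + n'"]) (simp add: algebra_simps)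
qed

lemma lattice_minus: "a \<in> lattice \<Longrightarrow> - a \<in> lattice"
  unfolding lattice_def
proof safe
  fix m n :: int
  show "\<exists>k l. - (of_int m * of_real pi + of_int n * (of_real pi * \<tau>))
      = of_int k * of_real pi + of_int l * (of_real pi * \<tau>) \<and> True"
    by (intro exI[of _ "- m"] exI[of _ "- n"]) simp
qed

text \<open>By real independence of pi and pi \<tau>: imaginary parts determine \<open>b\<close>,
  then real parts determine \<open>a\<close>.\<close>

lemma half_lattice_iff:
  "(of_int a * of_real pi + of_int b * (of_real pi * \<tau>)) / 2 \<in> lattice \<longleftrightarrow> even a \<and> even b"
proof
  assume "(of_int a * of_real pi + of_int b * (of_real pi * \<tau>)) / 2 \<in> lattice"
  then obtain m n where
    eq: "of_int a * of_real pi + of_int b * (of_real pi * \<tau>)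
      = 2 * (of_int m * of_real pi + of_int n * (of_real pi * \<tau>))"
    by (auto simp: lattice_def field_simps)
  from arg_cong[OF eq, of Im] have "(of_int b - 2 * of_int n) * (pi * Im \<tau>) = 0"
    by (simp add: algebra_simps)
  then have "real_of_int b = of_int (2 * n)"
    using Im_pos by simp
  then have b: "b = 2 * n" by (simp only: of_int_eq_iff)
  from arg_cong[OF eq, of Re] have "(of_int a - 2 * of_int m) * pi = 0"
    by (simp add: b algebra_simps)
  then have "real_of_int a = of_int (2 * m)"
    by simp
  then have "a = 2 * m" by (simp only: of_int_eq_iff)
  with b show "even a \<and> even b" by simp
next
  assume "even a \<and> even b"
  then obtain m n where "a = 2 * m" "b = 2 * n"
    by (auto elim!: evenE)
  then show "(of_int a * of_real pi + of_int b * (of_real pi * \<tau>)) / 2 \<in> lattice"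
    using latticeI[of m n] by (simp add: add_divide_distrib)
qed

lemma jtheta1_half_lattice:
  "jtheta1 ((of_int a * of_real pi + of_int b * (of_real pi * \<tau>)) / 2) \<tau> = 0 \<longleftrightarrow> even a \<and> even b"
  by (simp add: jtheta1_eq_0_iff half_lattice_iff)

text \<open>Twice \<open>z - w / 2\<close> plus the period \<open>w\<close> is \<open>2 * z\<close>.
  A single condition thus keeps the four denominators on the right-hand side of the theorem away
  from zero.\<close>

lemma jtheta1_double_nonzero:
  assumes "jtheta1 (2 * z) \<tau> \<noteq> 0"
  shows "jtheta1 (z - (of_int a * of_real pi + of_int b * (of_real pi * \<tau>)) / 2) \<tau> \<noteq> 0"
proof
  define w where "w = of_int a * of_real pi + of_int b * (of_real pi * \<tau>)"
  have "w \<in> lattice"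
    by (auto simp: w_def)
  assume "jtheta1 (z - (of_int a * of_real pi + of_int b * (of_real pi * \<tau>)) / 2) \<tau> = 0"
  then have "z - w / 2 \<in> lattice"
    by (simp add: jtheta1_eq_0_iff w_def)
  then have "(z - w / 2) + (z - w / 2) + w \<in> lattice"
    by (intro lattice_add \<open>w \<in> lattice\<close>)
  also have "(z - w / 2) + (z - w / 2) + w = 2 * z"
    by simp
  finally show False
    using assms by (simp add: jtheta1_eq_0_iff)
qed

text \<open>In contrast to \<open>jtheta2_eq_jtheta1\<close> the translation is backward, as in the
  two lemmas that follow; the half period subtracted is then the argument of \<open>f\<close> in the
  corresponding term of the theorem.\<close>

lemma jtheta2_eq: "jtheta2 z \<tau> = - jtheta1 (z - of_real pi / 2) \<tau>"
  using jtheta1_plus_pi[of "z - of_real pi / 2"]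
  by (simp add: jtheta2_eq_jtheta1 algebra_simps flip: add_divide_distrib)

lemma jtheta3_eq:
  "jtheta3 z \<tau> = - exp (\<i> * of_real pi * \<tau> / 4 - \<i> * z) * jtheta1 (z - (of_real pi + of_real pi * \<tau>) / 2) \<tau>"
proof -
  let ?x = "z - (of_real pi + of_real pi * \<tau>) / 2"
  have "jtheta1 (z + (of_real pi + of_real pi * \<tau>) / 2) \<tau> = jtheta1 (?x + of_real pi * \<tau> + of_real pi) \<tau>"
    by (simp add: field_simps)
  also have "\<dots> = exp (- (\<i> * of_real pi * \<tau> + 2 * \<i> * ?x)) * jtheta1 ?x \<tau>"
    by (simp add: jtheta1_plus_pi jtheta1_plus_pi_tau)
  also have "- (\<i> * of_real pi * \<tau> + 2 * \<i> * ?x) = \<i> * of_real pi - 2 * \<i> * z"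
    by (simp add: field_simps)
  finally have "jtheta1 (z + (of_real pi + of_real pi * \<tau>) / 2) \<tau> = - exp (- (2 * \<i> * z)) * jtheta1 ?x \<tau>"
    by (simp add: exp_diff exp_minus field_simps)
  then have "jtheta3 z \<tau> = - (exp (\<i> * of_real pi * \<tau> / 4 + \<i> * z) * exp (- (2 * \<i> * z))) * jtheta1 ?x \<tau>"
    by (simp add: jtheta3_eq_jtheta1)
  then show ?thesis
    by (simp add: algebra_simps flip: exp_add)
qed

lemma jtheta4_eq:
  "jtheta4 z \<tau> = \<i> * exp (\<i> * of_real pi * \<tau> / 4 - \<i> * z) * jtheta1 (z - of_real pi * \<tau> / 2) \<tau>"
proof -
  have "exp (\<i> * of_real pi * \<tau> / 4 - \<i> * (z + of_real pi / 2))
      = exp (\<i> * of_real pi * \<tau> / 4 - \<i> * z) * inverse (exp (\<i> * of_real (pi / 2)))"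
    by (simp add: algebra_simps flip: exp_add exp_minus)
  also have "exp (\<i> * of_real (pi / 2)) = \<i>"
    using cis_pi_half by (simp only: cis_conv_exp)
  finally have "exp (\<i> * of_real pi * \<tau> / 4 - \<i> * (z + of_real pi / 2))
      = - (\<i> * exp (\<i> * of_real pi * \<tau> / 4 - \<i> * z))"
    by simp
  moreover have "z + of_real pi / 2 - (of_real pi + of_real pi * \<tau>) / 2 = z - of_real pi * \<tau> / 2"
    by (simp add: field_simps)
  ultimately show ?thesis
    by (simp only: jtheta4_eq_jtheta3 jtheta3_eq minus_minus)
qed

text \<open>The factor \<open>exp (\<i> * y)\<close> in the theorem cancels exactly the change of
  the exponential prefactors of \<open>jtheta3\<close> and \<open>jtheta4\<close> between
  \<open>z\<close> and \<open>z + y\<close>.\<close>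

lemma jtheta_ratios:
  "jtheta2 (z + y) \<tau> / jtheta2 z \<tau>
     = jtheta1 (z - of_real pi / 2 + y) \<tau> / jtheta1 (z - of_real pi / 2) \<tau>" (is ?th2)
  "exp (\<i> * y) * jtheta3 (z + y) \<tau> / jtheta3 z \<tau>
     = jtheta1 (z - (of_real pi + of_real pi * \<tau>) / 2 + y) \<tau>
        / jtheta1 (z - (of_real pi + of_real pi * \<tau>) / 2) \<tau>" (is ?th3)
  "exp (\<i> * y) * jtheta4 (z + y) \<tau> / jtheta4 z \<tau>
     = jtheta1 (z - of_real pi * \<tau> / 2 + y) \<tau> / jtheta1 (z - of_real pi * \<tau> / 2) \<tau>" (is ?th4)
proof -
  have swap: "z + y - \<omega> = z - \<omega> + y" for \<omega> by simp
  have e: "exp (\<i> * y) * exp (\<i> * of_real pi * \<tau> / 4 - \<i> * (z + y)) = exp (\<i> * of_real pi * \<tau> / 4 - \<i> * z)"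
    by (simp add: algebra_simps flip: exp_add)
  show ?th2
    unfolding jtheta2_eq swap by simp
  show ?th3
    unfolding jtheta3_eq swap e[symmetric] by simp
  show ?th4
    unfolding jtheta4_eq swap e[symmetric] by simp
qed

lemma jtheta1_double_has_derivative:
  "((\<lambda>z. jtheta1 (2 * z) \<tau>) has_field_derivative deriv (\<lambda>z. jtheta1 z \<tau>) (2 * x) * 2) (at x)"
proof (rule DERIV_chain2[where f = "\<lambda>z. jtheta1 z \<tau>" and g = "(*) 2"])
  show "((\<lambda>z. jtheta1 z \<tau>) has_field_derivative deriv (\<lambda>z. jtheta1 z \<tau>) (2 * x)) (at (2 * x))"
    by (rule holomorphic_derivI[OF jtheta1_holomorphic]) auto
  show "((*) 2 has_field_derivative 2) (at x)"
    using DERIV_cmult_Id[of 2 x] by simp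
qed

lemma jtheta1_double_holomorphic: "(\<lambda>z. jtheta1 (2 * z) \<tau>) holomorphic_on UNIV"
  by (intro holomorphic_on_compose_gen[OF _ jtheta1_holomorphic, unfolded o_def]
      holomorphic_intros) auto

lemma jtheta1_double_simple_zero:
  assumes "jtheta1 (2 * z) \<tau> = 0"
  shows "deriv (\<lambda>z. jtheta1 (2 * z) \<tau>) z \<noteq> 0"
  using jtheta1_simple_zero[OF assms] DERIV_imp_deriv[OF jtheta1_double_has_derivative] by simp

text \<open>Doubling maps the lattice into itself, so the quotient is entire. Comparing derivatives
  at the simple zero 0 gives \<open>A 0 = 2\<close>, the source of the factor 2 on the left-hand
  side of the theorem.\<close>

lemma jtheta1_double_quotient:
  obtains A where "A holomorphic_on UNIV" "\<And>z. jtheta1 (2 * z) \<tau> = jtheta1 z \<tau> * A z" "A 0 = 2"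
proof -
  have "jtheta1 (2 * z) \<tau> = 0" if "jtheta1 z \<tau> = 0" for z
    using lattice_add[of z z] that by (simp add: jtheta1_eq_0_iff)
  then obtain A where A: "A holomorphic_on UNIV" "\<And>z. jtheta1 (2 * z) \<tau> = jtheta1 z \<tau> * A z"
    using entire_factor_simple_zeros[OF jtheta1_double_holomorphic jtheta1_holomorphic jtheta1_simple_zero] by metis
  let ?d = "deriv (\<lambda>z. jtheta1 z \<tau>) 0"
  have d: "((\<lambda>z. jtheta1 z \<tau>) has_field_derivative ?d) (at 0)"
    by (rule holomorphic_derivI[OF jtheta1_holomorphic]) auto
  have dA: "(A has_field_derivative deriv A 0) (at 0)"
    by (rule holomorphic_derivI[OF A(1)]) auto
  have "((\<lambda>z. jtheta1 (2 * z) \<tau>) has_field_derivative ?d * 2) (at 0)"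
    using jtheta1_double_has_derivative[of 0] by simp
  moreover have "((\<lambda>z. jtheta1 (2 * z) \<tau>) has_field_derivative ?d * A 0) (at 0)"
    unfolding A(2) using DERIV_mult[OF d dA] by simp
  ultimately have "?d * 2 = ?d * A 0"
    by (rule DERIV_unique)
  then have "A 0 = 2"
    using jtheta1_simple_zero[of 0] by simp
  with A show ?thesis by (rule that)
qed

text \<open>Lagrange interpolation at the four half periods. With the other theta functions replaced
  by translates of \<open>jtheta1\<close>, all four terms involve the one function \<phi>.\<close>

lemma interpolation_identity:
  assumes hol: "f holomorphic_on UNIV"
    and pi: "\<And>z. f (z + of_real pi) = f z"
    and tau: "\<And>z. f z = exp (4 * \<i> * of_real pi * \<tau> + 8 * \<i> * z + 2 * \<i> * y) * f (z + of_real pi * \<tau>)"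
    and nz: "jtheta1 (2 * z) \<tau> \<noteq> 0"
  defines "\<phi> \<equiv> (\<lambda>z. jtheta1 (z + y) \<tau> / jtheta1 z \<tau>)"
    and "\<omega>2 \<equiv> of_real pi * \<tau> / 2" and "\<omega>3 \<equiv> (of_real pi + of_real pi * \<tau>) / 2"
  shows "2 * jtheta1 y \<tau> * f z / jtheta1 (2 * z) \<tau>
    = f 0 * \<phi> z - f (of_real pi / 2) * \<phi> (z - of_real pi / 2)
      + nome * f \<omega>3 * \<phi> (z - \<omega>3) - nome * f \<omega>2 * \<phi> (z - \<omega>2)"
proof -
  let ?\<theta> = "\<lambda>z. jtheta1 z \<tau>"
  note nz_half = jtheta1_double_nonzero[OF nz]
  have nz0: "?\<theta> z \<noteq> 0" "?\<theta> (z - of_real pi / 2) \<noteq> 0" "?\<theta> (z - \<omega>3) \<noteq> 0" "?\<theta> (z - \<omega>2) \<noteq> 0"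
    using nz_half[of 0 0] nz_half[of 1 0] nz_half[of 1 1] nz_half[of 0 1]
    by (simp_all add: \<omega>2_def \<omega>3_def)
  show ?thesis
  proof (cases "y \<in> lattice")
    case True
    then obtain m n where y: "y = of_int m * of_real pi + of_int n * (of_real pi * \<tau>)"
      by (auto simp: lattice_def)
    \<comment> \<open>The exponential absorbs the dependence on \<open>y\<close> in the functional
      equation, so \<open>g\<close> satisfies the one for \<open>y = 0\<close>. The factor
      \<open>K\<close> is the part of the lattice multiplier that is common to the four
      terms.\<close>
    define g where "g = (\<lambda>z. exp (2 * \<i> * of_int n * z) * f z)"
    define K where "K = exp (- (\<i> * of_real pi * of_int m + \<i> * of_real pi * of_int n
            + \<i> * of_real pi * \<tau> * (of_int n)\<^sup>2 + 2 * \<i> * of_int n * z))"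
    have "exp (2 * \<i> * of_int n * (x + of_real pi)) = exp (2 * \<i> * of_int n * x)" for x
    proof -
      have "2 * \<i> * of_int n * (x + of_real pi) = 2 * \<i> * of_int n * x + 2 * of_int n * of_real pi * \<i>"
        by (simp add: algebra_simps)
      then show ?thesis by (simp only: exp_plus_2pi_int)
    qed
    then have g_pi: "g (x + of_real pi) = g x" for x
      by (simp add: g_def pi)
    have e2y: "exp (2 * \<i> * y) = exp (2 * \<i> * of_int n * (of_real pi * \<tau>))"
    proof -
      have "2 * \<i> * y = 2 * \<i> * of_int n * (of_real pi * \<tau>) + 2 * of_int m * of_real pi * \<i>"
        by (simp add: y algebra_simps)
      then show ?thesis by (simp only: exp_plus_2pi_int)
    qed
    have g_tau: "g x = exp (4 * \<i> * of_real pi * \<tau> + 8 * \<i> * x) * g (x + of_real pi * \<tau>)" for x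
    proof -
      have "g x = exp (2 * \<i> * of_int n * x) * (exp (4 * \<i> * of_real pi * \<tau> + 8 * \<i> * x)
          * exp (2 * \<i> * y) * f (x + of_real pi * \<tau>))"
        unfolding g_def by (subst tau) (simp add: exp_add)
      also have "\<dots> = exp (4 * \<i> * of_real pi * \<tau> + 8 * \<i> * x) * g (x + of_real pi * \<tau>)"
        unfolding g_def e2y by (simp add: distrib_left exp_add)
      finally show ?thesis .
    qed
    have \<phi>: "f \<omega> * \<phi> (z - \<omega>) = K * g \<omega>" if "?\<theta> (z - \<omega>) \<noteq> 0" for \<omega>
    proof -
      have "?\<theta> (z - \<omega> + y) = K * exp (2 * \<i> * of_int n * \<omega>) * ?\<theta> (z - \<omega>)"
        unfolding y quasiperiodic_lattice_shift[of ?\<theta>, OF jtheta1_plus_pi jtheta1_plus_pi_tau] K_def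
        by (simp add: algebra_simps flip: exp_add)
      then show ?thesis
        using that by (simp add: \<phi>_def g_def)
    qed
    have "g holomorphic_on UNIV"
      unfolding g_def by (intro holomorphic_intros hol)
    from half_period_values_relation[OF this g_pi g_tau]
    have "g 0 - g (of_real pi / 2) + nome * g \<omega>3 - nome * g \<omega>2 = 0"
      by (simp add: \<omega>2_def \<omega>3_def)
    moreover have "f 0 * \<phi> z - f (of_real pi / 2) * \<phi> (z - of_real pi / 2)
      + nome * f \<omega>3 * \<phi> (z - \<omega>3) - nome * f \<omega>2 * \<phi> (z - \<omega>2)
      = K * (g 0 - g (of_real pi / 2) + nome * g \<omega>3 - nome * g \<omega>2)"
      using \<phi>[of 0] \<phi>[of "of_real pi / 2"] \<phi>[of \<omega>3] \<phi>[of \<omega>2] nz0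
      by (simp add: algebra_simps)
    moreover have "?\<theta> y = 0"
      using True by (simp add: jtheta1_eq_0_iff)
    ultimately show ?thesis by simp
  next
    case False
    obtain A where A: "A holomorphic_on UNIV" "\<And>z. ?\<theta> (2 * z) = ?\<theta> z * A z" "A 0 = 2"
      by (rule jtheta1_double_quotient) blast
    obtain a where a: "?\<theta> a \<noteq> 0"
      using jtheta1_not_identically_zero by blast
    have shift_hol: "(\<lambda>z. h (z + w)) holomorphic_on UNIV" if "h holomorphic_on UNIV" for h :: "complex \<Rightarrow> complex" and w
      by (intro holomorphic_on_compose_gen[OF _ that, unfolded o_def] holomorphic_intros) auto
    have diff_hol: "(\<lambda>z. h (z - w)) holomorphic_on UNIV" if "h holomorphic_on UNIV" for h :: "complex \<Rightarrow> complex" and w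
      using shift_hol[OF that, of "- w"] by simp
    have \<theta>2_pi: "?\<theta> (2 * (z + of_real pi)) = ?\<theta> (2 * z)" for z
      using jtheta1_plus_pi[of "2 * z"] jtheta1_plus_pi[of "2 * z + of_real pi"]
      by (simp add: algebra_simps)
    have \<theta>2_tau: "?\<theta> (2 * (z + of_real pi * \<tau>))
        = exp (- (4 * \<i> * of_real pi * \<tau> + 8 * \<i> * z)) * ?\<theta> (2 * z)" for z
    proof -
      have "?\<theta> (2 * (z + of_real pi * \<tau>)) = ?\<theta> (2 * z + of_real pi * \<tau> + of_real pi * \<tau>)"
        by (simp add: algebra_simps)
      also have "\<dots> = (exp (- (\<i> * of_real pi * \<tau> + 2 * \<i> * (2 * z + of_real pi * \<tau>)))
          * exp (- (\<i> * of_real pi * \<tau> + 2 * \<i> * (2 * z)))) * ?\<theta> (2 * z)"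
        by (simp only: jtheta1_plus_pi_tau) simp
      finally show ?thesis
        by (simp add: algebra_simps flip: exp_add)
    qed
    have A_pi: "A (z + of_real pi) = - A z" for z
    proof (rule entire_mult_left_cancel[OF jtheta1_holomorphic shift_hol[OF A(1)] _ a])
      show "(\<lambda>z. - A z) holomorphic_on UNIV"
        by (intro holomorphic_intros A(1))
      show "?\<theta> z * A (z + of_real pi) = ?\<theta> z * - A z" for z
        using \<theta>2_pi[of z] unfolding A(2) by (simp add: jtheta1_plus_pi minus_equation_iff)
    qed
    have A_tau: "A (z + of_real pi * \<tau>) = - exp (- (3 * \<i> * of_real pi * \<tau> + 6 * \<i> * z)) * A z" for z
    proof (rule entire_mult_left_cancel[OF jtheta1_holomorphic shift_hol[OF A(1)] _ a])
      show "(\<lambda>z. - exp (- (3 * \<i> * of_real pi * \<tau> + 6 * \<i> * z)) * A z) holomorphic_on UNIV"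
        by (intro holomorphic_intros A(1))
      show "?\<theta> z * A (z + of_real pi * \<tau>)
          = ?\<theta> z * (- exp (- (3 * \<i> * of_real pi * \<tau> + 6 * \<i> * z)) * A z)" for z
      proof -
        have "exp (- (4 * \<i> * of_real pi * \<tau> + 8 * \<i> * z))
            = exp (- (\<i> * of_real pi * \<tau> + 2 * \<i> * z)) * exp (- (3 * \<i> * of_real pi * \<tau> + 6 * \<i> * z))"
          by (simp add: algebra_simps flip: exp_add)
        from \<theta>2_tau[of z, unfolded A(2) jtheta1_plus_pi_tau this]
        have "- (exp (- (\<i> * of_real pi * \<tau> + 2 * \<i> * z)) * ?\<theta> z * A (z + of_real pi * \<tau>))
            = exp (- (\<i> * of_real pi * \<tau> + 2 * \<i> * z))
              * (exp (- (3 * \<i> * of_real pi * \<tau> + 6 * \<i> * z)) * (?\<theta> z * A z))"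
          by (simp only: mult.assoc mult_minus_left)
        then have "?\<theta> z * A (z + of_real pi * \<tau>)
            = - (exp (- (3 * \<i> * of_real pi * \<tau> + 6 * \<i> * z)) * (?\<theta> z * A z))"
          by (rule neg_mult_left_cancel) simp
        then show ?thesis by simp
      qed
    qed
    \<comment> \<open>The pole-free form of \<open>\<phi> z * jtheta1 (2 * z) \<tau>\<close>. It
      acts as a Lagrange basis function: its value at 0 is \<open>2 * jtheta1 y \<tau>\<close>, and
      it vanishes at the half periods outside the lattice.\<close>
    define B where "B = (\<lambda>z. ?\<theta> (z + y) * A z)"
    have holB: "B holomorphic_on UNIV"
      unfolding B_def by (intro holomorphic_intros A(1) shift_hol jtheta1_holomorphic)
    have B0: "B 0 = 2 * ?\<theta> y"
      by (simp add: B_def A)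
    have B_half: "B x = 0"
      if "x = (of_int a * of_real pi + of_int b * (of_real pi * \<tau>)) / 2" "odd a \<or> odd b" for x a b
    proof -
      have "?\<theta> x \<noteq> 0"
        unfolding that(1) jtheta1_half_lattice using that(2) by simp
      moreover have "?\<theta> (2 * x) = 0"
        using latticeI[of a b] that(1) unfolding jtheta1_eq_0_iff by (metis nonzero_mult_div_cancel_left
            times_divide_eq_right zero_neq_numeral)
      ultimately show ?thesis
        by (simp add: A(2) B_def)
    qed
    have B_pi: "B (z + of_real pi) = B z" for z
      using jtheta1_plus_pi[of "z + y"] by (simp add: B_def A_pi add_ac)
    have B_tau: "B (z + of_real pi * \<tau>) = exp (- (4 * \<i> * of_real pi * \<tau> + 8 * \<i> * z + 2 * \<i> * y)) * B z" for z
    proof -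
      have "?\<theta> (z + of_real pi * \<tau> + y) = - exp (- (\<i> * of_real pi * \<tau> + 2 * \<i> * (z + y))) * ?\<theta> (z + y)"
        using jtheta1_plus_pi_tau[of "z + y"] by (simp add: add_ac)
      then have "B (z + of_real pi * \<tau>) = (exp (- (\<i> * of_real pi * \<tau> + 2 * \<i> * (z + y)))
          * exp (- (3 * \<i> * of_real pi * \<tau> + 6 * \<i> * z))) * B z"
        by (simp add: B_def A_tau)
      then show ?thesis
        by (simp add: algebra_simps flip: exp_add)
    qed
    \<comment> \<open>The identity multiplied by jtheta1 (2 z); the exponentials are the quasi-periodicity factors
        of jtheta1 that relate jtheta1 (2 z) to jtheta1 (2 (z - half period)).\<close>
    define E where "E = (\<lambda>z. 2 * ?\<theta> y * f z - (f 0 * B z + f (of_real pi / 2) * B (z - of_real pi / 2)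
        + f \<omega>3 * (exp (- (4 * \<i> * (z - \<omega>3))) * B (z - \<omega>3))
        + f \<omega>2 * (exp (- (4 * \<i> * (z - \<omega>2))) * B (z - \<omega>2))))"
    have holE: "E holomorphic_on UNIV"
      unfolding E_def by (intro holomorphic_intros hol holB diff_hol)
    have e4_pi: "exp (- (4 * \<i> * (x + of_real pi))) = exp (- (4 * \<i> * x))" for x
    proof -
      have "- (4 * \<i> * (x + of_real pi)) = - (4 * \<i> * x) + 2 * of_int (- 2) * of_real pi * \<i>"
        by (simp add: algebra_simps)
      then show ?thesis by (simp only: exp_plus_2pi_int)
    qed
    have sh: "z + w - \<omega> = z - \<omega> + w" for z w \<omega> :: complex by simp
    have E_pi: "E (z + of_real pi) = E z" for z
      unfolding E_def sh pi B_pi e4_pi ..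
    define \<mu> where "\<mu> = (\<lambda>z. exp (- (4 * \<i> * of_real pi * \<tau> + 8 * \<i> * z + 2 * \<i> * y)))"
    have E_tau: "E (z + of_real pi * \<tau>) = \<mu> z * E z" for z
    proof -
      have 1: "f (z + of_real pi * \<tau>) = \<mu> z * f z"
        by (subst tau[of z]) (simp only: \<mu>_def exp_minus mult.assoc[symmetric], simp)
      have 2: "B (z + of_real pi * \<tau>) = \<mu> z * B z"
        unfolding \<mu>_def by (rule B_tau)
      have 3: "B (z - of_real pi / 2 + of_real pi * \<tau>) = \<mu> z * B (z - of_real pi / 2)"
      proof -
        have "- (4 * \<i> * of_real pi * \<tau> + 8 * \<i> * (z - of_real pi / 2) + 2 * \<i> * y)
            = - (4 * \<i> * of_real pi * \<tau> + 8 * \<i> * z + 2 * \<i> * y) + 2 * of_int 2 * of_real pi * \<i>"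
          by (simp add: algebra_simps)
        then show ?thesis
          unfolding B_tau \<mu>_def by (simp only: exp_plus_2pi_int)
      qed
      \<comment> \<open>Under the condition on \<omega> the change of the exponential by the period
        is compensated by the dependence of the multiplier of \<open>B\<close> on \<omega>.\<close>
      have 4: "exp (- (4 * \<i> * (z - \<omega> + of_real pi * \<tau>))) * B (z - \<omega> + of_real pi * \<tau>)
          = \<mu> z * (exp (- (4 * \<i> * (z - \<omega>))) * B (z - \<omega>))"
        if "exp (8 * \<i> * \<omega>) = exp (4 * \<i> * of_real pi * \<tau>)" for \<omega>
      proof -
        have "exp (- (4 * \<i> * (z - \<omega> + of_real pi * \<tau>)))
            * exp (- (4 * \<i> * of_real pi * \<tau> + 8 * \<i> * (z - \<omega>) + 2 * \<i> * y))
          = exp (- (4 * \<i> * (z - \<omega>))) * (\<mu> z * (exp (- (4 * \<i> * of_real pi * \<tau>)) * exp (8 * \<i> * \<omega>)))"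
          unfolding \<mu>_def exp_add[symmetric] by (rule arg_cong[of _ _ exp]) (simp add: algebra_simps)
        also have "exp (- (4 * \<i> * of_real pi * \<tau>)) * exp (8 * \<i> * \<omega>) = 1"
          unfolding that by (simp flip: exp_add)
        also have "exp (- (4 * \<i> * (z - \<omega>))) * (\<mu> z * 1) = \<mu> z * exp (- (4 * \<i> * (z - \<omega>)))"
          by simp
        finally show ?thesis
          by (simp only: B_tau mult.assoc[symmetric])
      qed
      have "8 * \<i> * \<omega>3 = 4 * \<i> * of_real pi * \<tau> + 2 * of_int 2 * of_real pi * \<i>"
        by (simp add: \<omega>3_def field_simps)
      then have "exp (8 * \<i> * \<omega>3) = exp (4 * \<i> * of_real pi * \<tau>)"
        by (simp only: exp_plus_2pi_int)
      note 5 = 4[OF this]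
      have "exp (8 * \<i> * \<omega>2) = exp (4 * \<i> * of_real pi * \<tau>)"
        by (simp add: \<omega>2_def mult_ac)
      note 6 = 4[OF this]
      show ?thesis
        unfolding E_def sh 1 2 3 5 6 by (simp only: algebra_simps)
    qed
    \<comment> \<open>At each node only the term in which \<open>B\<close> has argument 0 survives;
      its exponential is 1, and \<open>B 0\<close> is the coefficient of \<open>f z\<close>.\<close>
    have E_half: "E 0 = 0" "E (of_real pi / 2) = 0" "E \<omega>3 = 0" "E \<omega>2 = 0"
    proof -
      have "B (- (of_real pi / 2)) = 0" "B (of_real pi / 2) = 0"
        "B (- \<omega>2) = 0" "B \<omega>2 = 0" "B (- \<omega>3) = 0" "B \<omega>3 = 0"
        "B (of_real pi / 2 - \<omega>2) = 0" "B (\<omega>2 - of_real pi / 2) = 0"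
        "B (of_real pi / 2 - \<omega>3) = 0" "B (\<omega>3 - of_real pi / 2) = 0"
        "B (\<omega>2 - \<omega>3) = 0" "B (\<omega>3 - \<omega>2) = 0"
        using B_half[of _ "-1" 0] B_half[of _ 1 0] B_half[of _ 0 "-1"] B_half[of _ 0 1]
          B_half[of _ "-1" "-1"] B_half[of _ 1 1] B_half[of _ 1 "-1"] B_half[of _ "-1" 1]
        by (simp_all add: \<omega>2_def \<omega>3_def add_divide_distrib diff_divide_distrib)
      then show "E 0 = 0" "E (of_real pi / 2) = 0" "E \<omega>3 = 0" "E \<omega>2 = 0"
        by (simp_all add: E_def B0)
    qed
    have E_zero: "E x = 0" if "?\<theta> (2 * x) = 0" for x
    proof -
      have p1: "E (x + of_int m * of_real pi) = 0 \<longleftrightarrow> E x = 0" for x m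
        using periodic_of_int[where F = "\<lambda>z. E z = 0" and w = "of_real pi"] E_pi by simp
      have p2: "E (x + of_int m * (of_real pi * \<tau>)) = 0 \<longleftrightarrow> E x = 0" for x m
        using periodic_of_int[where F = "\<lambda>z. E z = 0" and w = "of_real pi * \<tau>"] E_tau
        by (simp add: \<mu>_def)
      obtain m n where mn: "2 * x = of_int m * of_real pi + of_int n * (of_real pi * \<tau>)"
        using \<open>?\<theta> (2 * x) = 0\<close> by (auto simp: jtheta1_eq_0_iff lattice_def)
      \<comment> \<open>Reduction modulo 2 leaves one of the four half periods, up to periods of the
        zero set of \<open>E\<close>.\<close>
      define r s where "r = m mod 2" and "s = n mod 2"
      have "m = 2 * (m div 2) + r" "n = 2 * (n div 2) + s"
        by (simp_all add: r_def s_def)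
      then have mn': "of_int m = 2 * of_int (m div 2) + (of_int r :: complex)"
          "of_int n = 2 * of_int (n div 2) + (of_int s :: complex)"
        by (metis of_int_add of_int_mult of_int_numeral)+
      have "2 * x = 2 * ((of_int r * of_real pi + of_int s * (of_real pi * \<tau>)) / 2
          + of_int (m div 2) * of_real pi + of_int (n div 2) * (of_real pi * \<tau>))"
        unfolding mn mn' by (simp add: field_simps)
      then have x: "x = (of_int r * of_real pi + of_int s * (of_real pi * \<tau>)) / 2
          + of_int (m div 2) * of_real pi + of_int (n div 2) * (of_real pi * \<tau>)"
        by (subst (asm) mult_left_cancel) simp_all
      have "r = 0 \<or> r = 1" "s = 0 \<or> s = 1"
        by (auto simp: r_def s_def)
      then have "E ((of_int r * of_real pi + of_int s * (of_real pi * \<tau>)) / 2) = 0"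
        using E_half by (auto simp: \<omega>2_def \<omega>3_def)
      then show ?thesis
        by (subst x) (simp only: p1 p2)
    qed
    obtain D where D: "D holomorphic_on UNIV" "\<And>z. E z = ?\<theta> (2 * z) * D z"
      using entire_factor_simple_zeros[OF holE jtheta1_double_holomorphic jtheta1_double_simple_zero E_zero] by metis
    have D_pi: "D (x + of_real pi) = D x" for x
    proof (rule entire_mult_left_cancel[OF jtheta1_double_holomorphic shift_hol[OF D(1)] D(1) nz])
      show "?\<theta> (2 * z) * D (z + of_real pi) = ?\<theta> (2 * z) * D z" for z
        using E_pi[of z] unfolding D(2) \<theta>2_pi .
    qed
    have D_tau: "D (x + of_real pi * \<tau>) = exp (- (2 * \<i> * y)) * D x" for x
    proof (rule entire_mult_left_cancel[OF jtheta1_double_holomorphic shift_hol[OF D(1)] _ nz])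
      show "(\<lambda>z. exp (- (2 * \<i> * y)) * D z) holomorphic_on UNIV"
        by (intro holomorphic_intros D(1))
      show "?\<theta> (2 * z) * D (z + of_real pi * \<tau>) = ?\<theta> (2 * z) * (exp (- (2 * \<i> * y)) * D z)" for z
      proof -
        have "\<mu> z = exp (- (4 * \<i> * of_real pi * \<tau> + 8 * \<i> * z)) * exp (- (2 * \<i> * y))"
          unfolding \<mu>_def exp_add[symmetric] by (simp add: algebra_simps)
        then show ?thesis
          using E_tau[of z] unfolding D(2) \<theta>2_tau by simp
      qed
    qed
    obtain c n where c: "\<And>z. D z = c * exp (2 * \<i> * of_int n * z)"
      and n: "c = 0 \<or> exp (- (2 * \<i> * y)) = exp (2 * \<i> * of_real pi * of_int n * \<tau>)"
      by (rule doubly_quasiperiodic_entire[OF D(1) D_pi D_tau]) auto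
    \<comment> \<open>A nonzero \<open>c\<close> would make \<open>exp (- (2 * \<i> * y))\<close>
      the multiplier of a pure exponential and so put \<open>y\<close> into the lattice.\<close>
    have "c = 0"
    proof (rule ccontr)
      assume "c \<noteq> 0"
      with n have "- y \<in> lattice"
        by (intro exp_in_nome_powers_imp_lattice[of _ n]) simp
      then show False
        using lattice_minus[of "- y"] False by simp
    qed
    then have "E z = 0"
      by (simp add: D(2) c)
    then have main: "2 * ?\<theta> y * f z = f 0 * B z + f (of_real pi / 2) * B (z - of_real pi / 2)
        + f \<omega>3 * (exp (- (4 * \<i> * (z - \<omega>3))) * B (z - \<omega>3))
        + f \<omega>2 * (exp (- (4 * \<i> * (z - \<omega>2))) * B (z - \<omega>2))"
      by (simp add: E_def)
    have B\<phi>: "B x = ?\<theta> (2 * x) * \<phi> x" if "?\<theta> x \<noteq> 0" for x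
      using that by (simp add: B_def A(2) \<phi>_def)
    \<comment> \<open>Moving \<open>2 * z\<close> back by pi gives the factor -1; moving it back by
      pi \<tau> gives, together with the exponential, the factor \<open>- nome\<close>, and both
      moves give \<open>nome\<close>. These are the signs and coefficients of the theorem.\<close>
    have t1: "?\<theta> (2 * (z - of_real pi / 2)) = - ?\<theta> (2 * z)"
      using jtheta1_plus_pi[of "2 * (z - of_real pi / 2)"] by (simp add: algebra_simps)
    have t2: "exp (- (4 * \<i> * (z - \<omega>2))) * ?\<theta> (2 * (z - \<omega>2)) = - nome * ?\<theta> (2 * z)"
    proof -
      have "?\<theta> (2 * z) = ?\<theta> (2 * (z - \<omega>2) + of_real pi * \<tau>)"
        by (simp add: \<omega>2_def algebra_simps)
      also have "\<dots> = - exp (- (\<i> * of_real pi * \<tau> + 2 * \<i> * (2 * (z - \<omega>2)))) * ?\<theta> (2 * (z - \<omega>2))"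
        by (rule jtheta1_plus_pi_tau)
      finally have "- nome * ?\<theta> (2 * z)
        = (nome * exp (- (\<i> * of_real pi * \<tau> + 2 * \<i> * (2 * (z - \<omega>2))))) * ?\<theta> (2 * (z - \<omega>2))"
        by simp
      also have "nome * exp (- (\<i> * of_real pi * \<tau> + 2 * \<i> * (2 * (z - \<omega>2)))) = exp (- (4 * \<i> * (z - \<omega>2)))"
        unfolding nome_def exp_add[symmetric] by (rule arg_cong[of _ _ exp]) (simp add: algebra_simps)
      finally show ?thesis ..
    qed
    have t3: "exp (- (4 * \<i> * (z - \<omega>3))) * ?\<theta> (2 * (z - \<omega>3)) = nome * ?\<theta> (2 * z)"
    proof -
      have "z - \<omega>2 = z - \<omega>3 + of_real pi / 2"
        by (simp add: \<omega>2_def \<omega>3_def field_simps)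
      then have "?\<theta> (2 * (z - \<omega>2)) = ?\<theta> (2 * (z - \<omega>3) + of_real pi)"
          "- (4 * \<i> * (z - \<omega>3)) = - (4 * \<i> * (z - \<omega>2)) + 2 * of_int 1 * of_real pi * \<i>"
        by (simp_all add: algebra_simps)
      then have "?\<theta> (2 * (z - \<omega>3)) = - ?\<theta> (2 * (z - \<omega>2))"
          "exp (- (4 * \<i> * (z - \<omega>3))) = exp (- (4 * \<i> * (z - \<omega>2)))"
        by (simp_all only: jtheta1_plus_pi exp_plus_2pi_int) simp_all
      then show ?thesis using t2 by simp
    qed
    have "2 * ?\<theta> y * f z = (f 0 * \<phi> z - f (of_real pi / 2) * \<phi> (z - of_real pi / 2)
      + nome * f \<omega>3 * \<phi> (z - \<omega>3) - nome * f \<omega>2 * \<phi> (z - \<omega>2)) * ?\<theta> (2 * z)"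
    proof -
      have "exp (- (4 * \<i> * (z - \<omega>3))) * B (z - \<omega>3) = nome * ?\<theta> (2 * z) * \<phi> (z - \<omega>3)"
        "exp (- (4 * \<i> * (z - \<omega>2))) * B (z - \<omega>2) = - nome * ?\<theta> (2 * z) * \<phi> (z - \<omega>2)"
        unfolding B\<phi>[OF nz0(3)] B\<phi>[OF nz0(4)] mult.assoc[symmetric] t2 t3 by (rule refl)+
      then show ?thesis
        unfolding main B\<phi>[OF nz0(1)] B\<phi>[OF nz0(2)] t1 by (simp add: algebra_simps)
    qed
    then show ?thesis
      using nz by simp
  qed
qed

end

section \<open>The identity of meromorphic functions\<close>

theorem theorem1p11:
  fixes \<tau> y :: complex and f :: "complex \<Rightarrow> complex"
  defines "L \<equiv> (\<lambda>z. 2 * jtheta1 y \<tau> * f z / jtheta1 (2 * z) \<tau>)"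
    and "R \<equiv> (\<lambda>z.
           f 0 * (jtheta1 (z + y) \<tau> / jtheta1 z \<tau>)
         - f (of_real pi / 2) * (jtheta2 (z + y) \<tau> / jtheta2 z \<tau>)
         + qpow \<tau> (1/2) * f ((of_real pi + of_real pi * \<tau>) / 2)
             * (exp (\<i> * y) * jtheta3 (z + y) \<tau> / jtheta3 z \<tau>)
         - qpow \<tau> (1/2) * f (of_real pi * \<tau> / 2)
             * (exp (\<i> * y) * jtheta4 (z + y) \<tau> / jtheta4 z \<tau>))"
  assumes "Im \<tau> > 0"
    and "f holomorphic_on UNIV"
    and "\<And>z. f z = f (z + of_real pi)"
    and "\<And>z. f z = qpow \<tau> 2 * exp (8 * \<i> * z + 2 * \<i> * y) * f (z + of_real pi * \<tau>)"
  shows "L meromorphic_on UNIV \<and> R meromorphic_on UNIV \<and>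
         (\<forall>\<^sub>\<approx>z. jtheta1 (2 * z) \<tau> \<noteq> 0 \<and> jtheta1 z \<tau> \<noteq> 0 \<and> jtheta2 z \<tau> \<noteq> 0 \<and>
               jtheta3 z \<tau> \<noteq> 0 \<and> jtheta4 z \<tau> \<noteq> 0 \<and> L z = R z)"
proof -
  interpret upper_half_plane \<tau>
    by unfold_locales (rule assms)
  let ?\<theta> = "\<lambda>z. jtheta1 z \<tau>"
  have q: "qpow \<tau> (1 / 2) = nome"
    by (simp add: qpow_def nome_def mult_ac)
  have R: "R z = f 0 * (?\<theta> (z + y) / ?\<theta> z)
      - f (of_real pi / 2) * (?\<theta> (z - of_real pi / 2 + y) / ?\<theta> (z - of_real pi / 2))
      + nome * f ((of_real pi + of_real pi * \<tau>) / 2)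
          * (?\<theta> (z - (of_real pi + of_real pi * \<tau>) / 2 + y) / ?\<theta> (z - (of_real pi + of_real pi * \<tau>) / 2))
      - nome * f (of_real pi * \<tau> / 2)
          * (?\<theta> (z - of_real pi * \<tau> / 2 + y) / ?\<theta> (z - of_real pi * \<tau> / 2))" for z
    unfolding R_def jtheta_ratios q ..
  have hol: "(\<lambda>z. ?\<theta> (h z)) meromorphic_on UNIV" if "h holomorphic_on UNIV" for h
  proof -
    have "(\<lambda>z. ?\<theta> (h z)) holomorphic_on UNIV"
      by (rule holomorphic_on_compose_gen[OF that jtheta1_holomorphic, unfolded o_def]) auto
    then show ?thesis
      by (intro analytic_on_imp_meromorphic_on) (simp add: analytic_on_open)
  qed
  have "f meromorphic_on UNIV"
    using assms(4) by (intro analytic_on_imp_meromorphic_on) (simp add: analytic_on_open)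
  then have "L meromorphic_on UNIV"
    unfolding L_def
    by (intro meromorphic_on_divide meromorphic_on_mult meromorphic_on_const hol holomorphic_intros)
  moreover have "R meromorphic_on UNIV"
    unfolding R [abs_def]
    by (intro meromorphic_on_add meromorphic_on_diff meromorphic_on_divide meromorphic_on_mult
        meromorphic_on_const hol holomorphic_intros)
  moreover have "?\<theta> z \<noteq> 0 \<and> jtheta2 z \<tau> \<noteq> 0 \<and> jtheta3 z \<tau> \<noteq> 0 \<and> jtheta4 z \<tau> \<noteq> 0 \<and> L z = R z"
    if nz: "?\<theta> (2 * z) \<noteq> 0" for z
  proof (intro conjI)
    note nz_half = jtheta1_double_nonzero[OF nz]
    show "?\<theta> z \<noteq> 0" "jtheta2 z \<tau> \<noteq> 0" "jtheta3 z \<tau> \<noteq> 0" "jtheta4 z \<tau> \<noteq> 0"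
      using nz_half[of 0 0] nz_half[of 1 0] nz_half[of 1 1] nz_half[of 0 1]
      by (simp_all add: jtheta2_eq jtheta3_eq jtheta4_eq)
    show "L z = R z"
      unfolding L_def R
    proof (rule interpolation_identity[OF assms(4) assms(5)[symmetric] _ nz])
      show "f z = exp (4 * \<i> * of_real pi * \<tau> + 8 * \<i> * z + 2 * \<i> * y) * f (z + of_real pi * \<tau>)" for z
        by (subst assms(6)) (simp add: qpow_def add_ac mult_ac flip: exp_add)
    qed
  qed
  moreover have "\<forall>\<^sub>\<approx>z. ?\<theta> (2 * z) \<noteq> 0"
  proof -
    obtain a where a: "?\<theta> a \<noteq> 0"
      using jtheta1_not_identically_zero by blast
    \<comment> \<open>An accumulation point of zeros would make the function vanish identically, so
      the exceptional set is sparse.\<close>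
    have "\<not> x islimpt {z. ?\<theta> (2 * z) = 0}" for x
    proof
      assume "x islimpt {z. ?\<theta> (2 * z) = 0}"
      then have "?\<theta> (2 * (a / 2)) = 0"
        using analytic_continuation[OF jtheta1_double_holomorphic open_UNIV connected_UNIV
            subset_UNIV UNIV_I, where \<xi> = x and w = "a / 2"] by blast
      with a show False by simp
    qed
    then show ?thesis
      by (simp add: eventually_cosparse sparse_in_open)
  qed
  ultimately show ?thesis
    by (auto elim!: eventually_mono)
qed

end
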